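(* Let $i\geq 2$ and $d\ge i+1$ be fixed integers, let $q$ be a prime integer, let $\beta_2,\beta_1>0$, and let $\mu=\mu_{\beta_2,\beta_1,q,i,\mathbb{Z}^d}$ be the infinite-volume Potts lattice Higgs model. For $n\in 2\mathbb{N}$ let $q_n=\partial\bigl([0,n]^{i+1}\times\{0\}^{d-i-1}\bigr)$ and let $q_n'$ and $q_n''$ be the $i$-chains formed by the upper and lower halves of $q_n$. Set $$R(\beta_2,\beta_1,n)=\frac{\mathbb{E}_{\mu}(W_{q_n'})\,\mathbb{E}_{\mu}(W_{q_n''})}{\mathbb{E}_{\mu}(W_{q_n})}=\frac{\mathbb{E}_{\mu}(W_{q_n'})^2}{\mathbb{E}_{\mu}(W_{q_n})}.$$ Then $$\lim_{n\to\infty}R(\beta_2,\beta_1,n)=0.$$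
   Context: $\mathbb{Z}^d$ denotes the cubical cell complex tessellating $\mathbb{R}^d$ by unit cubes with integer vertices. For a cell complex $X$, $X^{[j]}$ is the set of $j$-cells; $C^j(X;\mathbb{Z}_q)$ is the group of functions $f$ from oriented $j$-cells to $\mathbb{Z}_q$ (integers modulo $q$) with $f(-x)=-f(x)$, evaluated on $j$-chains with $\mathbb{Z}_q$ coefficients by linearity; $\delta f(x)=f(\partial x)$ with $\partial$ the cellular boundary. $I_0(y)$ is the indicator that $y=0$. For a finite complex $X$, $\mu_{\beta_2,\beta_1,q,i,X}$ is the probability measure on $C^i(X;\mathbb{Z}_q)$ with $\mu(f)\propto\exp\bigl(\beta_2\sum_{\sigma\in X^{[i+1]}}I_0(\delta f(\sigma))+\beta_1\sum_{\epsilon\in X^{[i]}}I_0(f(\epsilon))\bigr)$. The measure $\mu_{\beta_2,\beta_1,q,i,\mathbb{Z}^d}$ is the weak limit as $N\to\infty$ of $\mu_{\beta_2,\beta_1,q,i,\Lambda_N}$ with $\Lambda_N=[-N,N]^d$ (free boundary conditions); this limit exists. For an $i$-chain $\gamma$, $W_\gamma(f)=\exp\bigl(\frac{2\pi\sqrt{-1}}{q}f(\gamma)\bigr)$. The $i$-chain $q_n$ is the oriented boundary of the $(i+1)$-dimensional cube $[0,n]^{i+1}\times\{0\}^{d-i-1}$; its upper and lower halves $q_n',q_n''$ are the restrictions of $q_n$ to the $i$-cells with $(i+1)$-st coordinate $\ge n/2$ and $\le n/2$ respectively, so $q_n=q_n'+q_n''$. *)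

theory Defs
  imports "HOL-Probability.Probability" "HOL-Library.Poly_Mapping"
begin

text \<open>
  The pair \<open>(v, S)\<close> stands for the cube
  \<open>{x. (\<forall>k\<in>S. v k \<le> x k \<le> v k + 1) \<and> (\<forall>k. k \<notin> S \<longrightarrow> x k = v k)}\<close>,
  with the reference orientation given by the increasing order of the directions in \<open>S\<close>.
  Coordinates are numbered from 0.
\<close>

type_synonym cell = "(nat \<Rightarrow> int) \<times> nat set"

definition lower :: "cell \<Rightarrow> nat \<Rightarrow> int" where
  "lower x k = fst x k"

definition upper :: "cell \<Rightarrow> nat \<Rightarrow> int" where
  "upper x k = fst x k + of_bool (k \<in> snd x)"

definition cubical_lattice :: "nat \<Rightarrow> cell set" where
  "cubical_lattice d = {(v, S). (\<forall>k\<ge>d. v k = 0) \<and> S \<subseteq> {..<d}}"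

definition box :: "nat \<Rightarrow> nat \<Rightarrow> cell set" where
  "box d N = {x \<in> cubical_lattice d. \<forall>k<d. - int N \<le> lower x k \<and> upper x k \<le> int N}"

definition cells :: "cell set \<Rightarrow> nat \<Rightarrow> cell set" where
  "cells X j = {x \<in> X. card (snd x) = j}"

text \<open>
  Only integral chains are needed; they act on \<open>\<int>/q\<close>-valued cochains through
  reduction of the coefficients modulo \<open>q\<close>.
\<close>

type_synonym chain = "cell \<Rightarrow>\<^sub>0 int"

definition bdry_cell :: "cell \<Rightarrow> chain" where
  "bdry_cell = (\<lambda>(v, S). \<Sum>k\<in>S. frag_cmul ((-1) ^ card {l \<in> S. l < k})
     (frag_of (v(k := v k + 1), S - {k}) - frag_of (v, S - {k})))"

definition bdry :: "chain \<Rightarrow> chain" where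
  "bdry = frag_extend bdry_cell"

text \<open>
  The group \<open>\<int>/q\<close> is represented by the residues \<open>{0..<q}\<close>. A cochain is given by its
  values on the cells with their reference orientation; antisymmetry determines the
  values on the cells with the opposite orientation.
\<close>

definition cochains :: "nat \<Rightarrow> nat \<Rightarrow> cell set \<Rightarrow> (cell \<Rightarrow> int) set" where
  "cochains q j X = cells X j \<rightarrow>\<^sub>E {0..<int q}"

definition eval_chain :: "nat \<Rightarrow> (cell \<Rightarrow> int) \<Rightarrow> chain \<Rightarrow> int" where
  "eval_chain q f c = (\<Sum>x\<in>Poly_Mapping.keys c. Poly_Mapping.lookup c x * f x) mod int q"

definition coboundary :: "nat \<Rightarrow> (cell \<Rightarrow> int) \<Rightarrow> cell \<Rightarrow> int" where
  "coboundary q f x = eval_chain q f (bdry (frag_of x))"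

definition higgs_weight ::
    "real \<Rightarrow> real \<Rightarrow> nat \<Rightarrow> nat \<Rightarrow> cell set \<Rightarrow> (cell \<Rightarrow> int) \<Rightarrow> real" where
  "higgs_weight \<beta>\<^sub>2 \<beta>\<^sub>1 q i X f =
     exp (\<beta>\<^sub>2 * (\<Sum>\<sigma>\<in>cells X (i + 1). of_bool (coboundary q f \<sigma> = 0))
        + \<beta>\<^sub>1 * (\<Sum>\<epsilon>\<in>cells X i. of_bool (f \<epsilon> = 0)))"

definition higgs_measure ::
    "real \<Rightarrow> real \<Rightarrow> nat \<Rightarrow> nat \<Rightarrow> cell set \<Rightarrow> (cell \<Rightarrow> int) measure" where
  "higgs_measure \<beta>\<^sub>2 \<beta>\<^sub>1 q i X = point_measure (cochains q i X)
     (\<lambda>f. ennreal (higgs_weight \<beta>\<^sub>2 \<beta>\<^sub>1 q i X f /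
        (\<Sum>g\<in>cochains q i X. higgs_weight \<beta>\<^sub>2 \<beta>\<^sub>1 q i X g)))"

definition cochain_space :: "nat \<Rightarrow> nat \<Rightarrow> nat \<Rightarrow> (cell \<Rightarrow> int) measure" where
  "cochain_space q i d =
     PiM (cells (cubical_lattice d) i) (\<lambda>_. count_space {0..<int q})"

definition cochain_topology :: "nat \<Rightarrow> nat \<Rightarrow> nat \<Rightarrow> (cell \<Rightarrow> int) topology" where
  "cochain_topology q i d =
     product_topology (\<lambda>_. discrete_topology {0..<int q}) (cells (cubical_lattice d) i)"

text \<open>
  To compare measures on different boxes, a cochain on \<open>X\<close> is extended by 0 to the whole
  lattice. The choice of the extension is immaterial for the limit, since a cylinder event
  only involves cells that belong to all sufficiently large boxes.
\<close>

definition extend_zero ::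
    "nat \<Rightarrow> nat \<Rightarrow> cell set \<Rightarrow> (cell \<Rightarrow> int) \<Rightarrow> cell \<Rightarrow> int" where
  "extend_zero i d X f =
     (\<lambda>x\<in>cells (cubical_lattice d) i. if x \<in> cells X i then f x else 0)"

definition box_higgs_measure ::
    "real \<Rightarrow> real \<Rightarrow> nat \<Rightarrow> nat \<Rightarrow> nat \<Rightarrow> nat \<Rightarrow> (cell \<Rightarrow> int) measure" where
  "box_higgs_measure \<beta>\<^sub>2 \<beta>\<^sub>1 q i d N =
     distr (higgs_measure \<beta>\<^sub>2 \<beta>\<^sub>1 q i (box d N)) (cochain_space q i d)
       (extend_zero i d (box d N))"

definition weak_limit :: "'a topology \<Rightarrow> (nat \<Rightarrow> 'a measure) \<Rightarrow> 'a measure \<Rightarrow> bool" where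
  "weak_limit T M\<^sub>N M \<longleftrightarrow>
     (\<forall>g :: 'a \<Rightarrow> real. continuous_map T euclideanreal g \<and> bounded (g ` topspace T) \<longrightarrow>
        (\<lambda>N. integral\<^sup>L (M\<^sub>N N) g) \<longlonglongrightarrow> integral\<^sup>L M g)"

text \<open>
  The weak limit is unique, so the following predicate characterises the infinite-volume
  measure.
\<close>

definition is_infinite_higgs_measure ::
    "real \<Rightarrow> real \<Rightarrow> nat \<Rightarrow> nat \<Rightarrow> nat \<Rightarrow> (cell \<Rightarrow> int) measure \<Rightarrow> bool" where
  "is_infinite_higgs_measure \<beta>\<^sub>2 \<beta>\<^sub>1 q i d \<mu> \<longleftrightarrow>
     prob_space \<mu> \<and> sets \<mu> = sets (cochain_space q i d) \<and>
     weak_limit (cochain_topology q i d) (box_higgs_measure \<beta>\<^sub>2 \<beta>\<^sub>1 q i d) \<mu>"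

definition wilson :: "nat \<Rightarrow> chain \<Rightarrow> (cell \<Rightarrow> int) \<Rightarrow> complex" where
  "wilson q c f = exp (2 * of_real pi * \<i> / of_nat q * of_int (eval_chain q f c))"

text \<open>The cube \<open>[0,n]\<^sup>i\<^sup>+\<^sup>1 \<times> {0}\<^sup>d\<^sup>-\<^sup>i\<^sup>-\<^sup>1\<close> as a chain; it does not depend on \<open>d\<close>.\<close>

definition cube_chain :: "nat \<Rightarrow> nat \<Rightarrow> chain" where
  "cube_chain i n =
     (\<Sum>v\<in>{v. (\<forall>k\<le>i. 0 \<le> v k \<and> v k < int n) \<and> (\<forall>k>i. v k = 0)}. frag_of (v, {..i}))"

definition restrict_chain :: "(cell \<Rightarrow> bool) \<Rightarrow> chain \<Rightarrow> chain" where
  "restrict_chain P c =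
     (\<Sum>x\<in>{x \<in> Poly_Mapping.keys c. P x}. frag_cmul (Poly_Mapping.lookup c x) (frag_of x))"

definition q_loop :: "nat \<Rightarrow> nat \<Rightarrow> chain" where
  "q_loop i n = bdry (cube_chain i n)"

definition q_upper :: "nat \<Rightarrow> nat \<Rightarrow> chain" where
  "q_upper i n = restrict_chain (\<lambda>x. real_of_int (lower x i) \<ge> real n / 2) (q_loop i n)"

definition q_lower :: "nat \<Rightarrow> nat \<Rightarrow> chain" where
  "q_lower i n = restrict_chain (\<lambda>x. real_of_int (upper x i) \<le> real n / 2) (q_loop i n)"

definition mf_ratio :: "(cell \<Rightarrow> int) measure \<Rightarrow> nat \<Rightarrow> nat \<Rightarrow> nat \<Rightarrow> complex" where
  "mf_ratio \<mu> q i n =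
     integral\<^sup>L \<mu> (wilson q (q_upper i n)) * integral\<^sup>L \<mu> (wilson q (q_lower i n))
       / integral\<^sup>L \<mu> (wilson q (q_loop i n))"

end

theory Submission
  imports Defs
begin

text \<open>
  The ratio tends to 0 because forcing each half of the sphere to be trivial costs something at
  every cell of their common boundary, and that boundary has at least \<open>n\<close> cells as soon as
  \<open>i \<ge> 2\<close>. The argument runs in the random-cluster representation.

  The Gibbs weight is a product over cells \<open>c\<close> of factors \<open>1 + p\<^sub>c\<cdot>1[c is satisfied]\<close>, where an
  \<open>i\<close>-cell is satisfied if \<open>f\<close> vanishes on it, and an \<open>(i+1)\<close>-cell is satisfied if \<open>\<delta>f\<close> vanishes on it.
  Expanding the product over sets \<open>\<omega>\<close> of open cells leaves a sum over the group \<open>K(\<omega>)\<close>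
  of cochains satisfying all cells of \<open>\<omega>\<close>. The character \<open>W\<^sub>\<gamma>\<close> has average 1 over \<open>K(\<omega>)\<close> if
  \<open>\<gamma>\<close> is annihilated by \<open>K(\<omega>)\<close> (then \<open>\<omega>\<close> \<^emph>\<open>forces\<close> \<open>\<gamma>\<close>), and average 0
  otherwise. Hence \<open>E(W\<^sub>\<gamma>)\<close> is the probability that \<open>\<gamma>\<close> is forced, for the weight
  \<open>|K(\<omega>)| \<Prod> p\<^sub>c\<close> (\<open>random_cluster_expansion\<close>, \<open>expectation_phase\<close>). Forcing is increasing
  in \<open>\<omega>\<close>, and the weight is log-supermodular because \<open>|K + K'| |K \<inter> K'| = |K| |K'|\<close> for
  finite subgroups of an abelian group. The four functions inequality therefore yields positive
  association (\<open>mass_forces_both\<close>) and monotonicity in the volume (\<open>forcing_prob_le\<close>).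

  Positive association bounds \<open>E(W\<^sub>q\<^sub>') E(W\<^sub>q\<^sub>'')\<close> by the probability that both halves are
  forced. In such a configuration every \<open>(i-1)\<close>-cell \<open>x\<close> of the common boundary lies in an open
  \<open>i\<close>-cell: otherwise the coboundary of the indicator of \<open>x\<close> is an element of \<open>K(\<omega>)\<close> that does
  not annihilate the upper half (\<open>forces_meets_star\<close>). Now perform surgery at \<open>x\<close>: close the
  \<open>i\<close>-cells around \<open>x\<close> and open everything else in the neighbourhood. The closed sphere is
  still forced, because each element of the new \<open>K\<close> differs from an element of the old
  one by a multiple of that same coboundary, which annihilates the sphere
  (\<open>forces_after_surgery\<close>). The surgery changes boundedly many cells, so the weight changes by a bounded
  factor, and \<open>x\<close> can be recovered from the result as the only cell without an open
  \<open>i\<close>-cell around it. Summing over \<open>n\<close> choices of \<open>x\<close> produces \<open>n\<close> disjoint families of configurations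
  that force the sphere, each of mass at least a constant times the mass of the original event
  (\<open>mass_surgery\<close>). So the ratio is at most a constant over \<open>n\<close>, uniformly in the box.

  The equality of the expectations of the two halves comes from the reflection that
  exchanges them. It does not preserve the boxes, but it embeds each box into a larger one, so
  volume monotonicity gives both inequalities in the limit.
\<close>

section \<open>The four functions inequality\<close>

lemma sum_Pow_insert:
  fixes g :: "'a set \<Rightarrow> 'b :: comm_monoid_add"
  assumes "finite C" and "c \<notin> C"
  shows "(\<Sum>A\<in>Pow (insert c C). g A) = (\<Sum>A\<in>Pow C. g A + g (insert c A))"
proof -
  have "Pow C \<inter> insert c ` Pow C = {}" and "inj_on (insert c) (Pow C)"
    using assms(2) by (auto simp: inj_on_def)
  then show ?thesis
    using assms(1) by (simp add: Pow_insert sum.union_disjoint sum.reindex sum.distrib)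
qed

text \<open>
  The case of a one-point ground set. Only the mixed terms need an argument: if both factors of a
  product \<open>(u - a) (u - b)\<close> are nonnegative, \<open>u > 0\<close> and \<open>a b \<le> u v\<close>, then \<open>a + b \<le> u + v\<close>; here
  \<open>u = c1 * d0\<close> and \<open>v = c0 * d1\<close>.
\<close>

lemma four_functions_two_point:
  fixes a0 a1 b0 b1 c0 c1 d0 d1 :: real
  assumes nonneg: "a0 \<ge> 0" "a1 \<ge> 0" "b0 \<ge> 0" "b1 \<ge> 0" "c0 \<ge> 0" "c1 \<ge> 0" "d0 \<ge> 0" "d1 \<ge> 0"
    and "a0 * b0 \<le> c0 * d0" and "a0 * b1 \<le> c1 * d0" and "a1 * b0 \<le> c1 * d0"
    and "a1 * b1 \<le> c1 * d1"
  shows "(a0 + a1) * (b0 + b1) \<le> (c0 + c1) * (d0 + d1)"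
proof -
  have "a0 * b1 + a1 * b0 \<le> c1 * d0 + c0 * d1"
  proof (cases "c1 * d0 = 0")
    case True
    then have "a0 * b1 \<le> 0" "a1 * b0 \<le> 0"
      using assms(10,11) by linarith+
    moreover have "0 \<le> c1 * d0 + c0 * d1" using nonneg by simp
    ultimately show ?thesis by linarith
  next
    case False
    then have pos: "c1 * d0 > 0" using nonneg by (simp add: less_le)
    have "(a0 * b0) * (a1 * b1) \<le> (c0 * d0) * (c1 * d1)"
      by (rule mult_mono[OF assms(9,12)]) (use nonneg in auto)
    moreover have "(c1 * d0 - a0 * b1) * (c1 * d0 - a1 * b0) \<ge> 0"
      using assms by simp
    ultimately have "(c1 * d0) * (a0 * b1 + a1 * b0) \<le> (c1 * d0) * (c1 * d0 + c0 * d1)"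
      by (simp add: algebra_simps)
    then show ?thesis by (rule mult_left_le_imp_le[OF _ pos])
  qed
  then show ?thesis using assms by (simp add: algebra_simps)
qed

text \<open>
  The Ahlswede--Daykin inequality, by induction on the ground set: summing each function over
  the absence and presence of one point reduces the ground set by that point, and the two-point
  inequality shows that the hypothesis survives.
\<close>

lemma four_functions:
  fixes \<alpha> \<beta> \<gamma> \<delta> :: "'a set \<Rightarrow> real"
  assumes "finite C"
    and "\<And>A. A \<subseteq> C \<Longrightarrow> \<alpha> A \<ge> 0" and "\<And>A. A \<subseteq> C \<Longrightarrow> \<beta> A \<ge> 0"
    and "\<And>A. A \<subseteq> C \<Longrightarrow> \<gamma> A \<ge> 0" and "\<And>A. A \<subseteq> C \<Longrightarrow> \<delta> A \<ge> 0"
    and "\<And>A B. A \<subseteq> C \<Longrightarrow> B \<subseteq> C \<Longrightarrow> \<alpha> A * \<beta> B \<le> \<gamma> (A \<union> B) * \<delta> (A \<inter> B)"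
  shows "(\<Sum>A\<in>Pow C. \<alpha> A) * (\<Sum>A\<in>Pow C. \<beta> A) \<le> (\<Sum>A\<in>Pow C. \<gamma> A) * (\<Sum>A\<in>Pow C. \<delta> A)"
  using assms
proof (induction C arbitrary: \<alpha> \<beta> \<gamma> \<delta> rule: finite_induct)
  case empty
  from empty.prems(5)[of "{}" "{}"] show ?case by simp
next
  case (insert c C)
  have fold: "(\<Sum>A\<in>Pow (insert c C). g A) = (\<Sum>A\<in>Pow C. g A + g (insert c A))"
    for g :: "'a set \<Rightarrow> real"
    using insert.hyps by (rule sum_Pow_insert)
  show ?case
    unfolding fold
  proof (rule insert.IH)
    fix A B assume AB: "A \<subseteq> C" "B \<subseteq> C"
    then have c: "c \<notin> A" "c \<notin> B" using insert.hyps by auto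
    have sub: "A \<subseteq> insert c C" "B \<subseteq> insert c C" "insert c A \<subseteq> insert c C"
      "insert c B \<subseteq> insert c C" "A \<union> B \<subseteq> insert c C" "A \<inter> B \<subseteq> insert c C"
      "insert c (A \<union> B) \<subseteq> insert c C" "insert c (A \<inter> B) \<subseteq> insert c C"
      using AB by auto
    show "(\<alpha> A + \<alpha> (insert c A)) * (\<beta> B + \<beta> (insert c B)) \<le>
        (\<gamma> (A \<union> B) + \<gamma> (insert c (A \<union> B))) * (\<delta> (A \<inter> B) + \<delta> (insert c (A \<inter> B)))"
    proof (rule four_functions_two_point)
      show "\<alpha> A * \<beta> (insert c B) \<le> \<gamma> (insert c (A \<union> B)) * \<delta> (A \<inter> B)"
        using insert.prems(5)[OF sub(1,4)] c by simp
      show "\<alpha> (insert c A) * \<beta> B \<le> \<gamma> (insert c (A \<union> B)) * \<delta> (A \<inter> B)"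
        using insert.prems(5)[OF sub(3,2)] c by simp
      show "\<alpha> (insert c A) * \<beta> (insert c B) \<le> \<gamma> (insert c (A \<union> B)) * \<delta> (insert c (A \<inter> B))"
        using insert.prems(5)[OF sub(3,4)] c by simp
      show "\<alpha> A * \<beta> B \<le> \<gamma> (A \<union> B) * \<delta> (A \<inter> B)"
        by (rule insert.prems(5)[OF sub(1,2)])
    qed (intro sub insert.prems(1-4))+
  qed (intro add_nonneg_nonneg insert.prems(1-4); auto)+
qed

section \<open>The random-cluster expansion\<close>

text \<open>
  In the applications \<open>\<phi>\<close> is a homomorphism of finite groups, and subtracting a fixed element maps
  each fibre injectively into the kernel \<open>H\<close>.
\<close>

lemma card_le_card_mult_fibre_bound:
  assumes "finite T" and "finite H" and "\<phi> ` A \<subseteq> T"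
    and fibre: "\<And>a. a \<in> A \<Longrightarrow> \<exists>g. inj_on g {b \<in> A. \<phi> b = \<phi> a} \<and> g ` {b \<in> A. \<phi> b = \<phi> a} \<subseteq> H"
  shows "card A \<le> card T * card H"
proof (cases "finite A")
  case True
  have "card A = (\<Sum>t\<in>\<phi> ` A. card {b \<in> A. \<phi> b = t})"
    using True by (subst card_eq_sum, subst sum.image_gen[of A _ \<phi>]) simp_all
  also have "\<dots> \<le> (\<Sum>t\<in>\<phi> ` A. card H)"
    using fibre card_inj_on_le[OF _ _ assms(2)] by (intro sum_mono) blast
  also have "\<dots> \<le> card T * card H"
    using assms(1,3) by (simp add: card_mono)
  finally show ?thesis .
qed simp

definition pairing :: "'e set \<Rightarrow> ('e \<Rightarrow> int) \<Rightarrow> ('e \<Rightarrow> int) \<Rightarrow> int" where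
  "pairing E a f = (\<Sum>e\<in>E. a e * f e)"

lemma pairing_add: "pairing E a (\<lambda>e. f e + g e) = pairing E a f + pairing E a g"
  by (simp add: pairing_def algebra_simps sum.distrib)

lemma pairing_diff: "pairing E a (\<lambda>e. f e - g e) = pairing E a f - pairing E a g"
  by (simp add: pairing_def algebra_simps sum_subtractf)

lemma pairing_scale: "pairing E a (\<lambda>e. t * f e) = t * pairing E a f"
  by (simp add: pairing_def sum_distrib_left algebra_simps)

lemma pairing_add_left: "pairing E (\<lambda>e. a e + b e) f = pairing E a f + pairing E b f"
  by (simp add: pairing_def algebra_simps sum.distrib)

definition spins :: "nat \<Rightarrow> 'e set \<Rightarrow> ('e \<Rightarrow> int) set" where
  "spins q E = E \<rightarrow>\<^sub>E {0..<int q}"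

definition reduce_mod :: "nat \<Rightarrow> 'e set \<Rightarrow> ('e \<Rightarrow> int) \<Rightarrow> 'e \<Rightarrow> int" where
  "reduce_mod q E f = (\<lambda>e\<in>E. f e mod int q)"

lemma reduce_mod_spins: "q > 0 \<Longrightarrow> reduce_mod q E f \<in> spins q E"
  by (auto simp: reduce_mod_def spins_def)

lemma reduce_mod_eqD:
  assumes "reduce_mod q E f = reduce_mod q E g" and "e \<in> E"
  shows "int q dvd f e - g e"
  using fun_cong[OF assms(1), of e] assms(2) by (simp add: reduce_mod_def mod_eq_dvd_iff)

lemma spins_eqI:
  assumes "f \<in> spins q E" and "g \<in> spins q E" and "\<And>e. e \<in> E \<Longrightarrow> int q dvd f e - g e"
  shows "f = g"
proof (rule PiE_ext)
  show "f \<in> E \<rightarrow>\<^sub>E {0..<int q}" "g \<in> E \<rightarrow>\<^sub>E {0..<int q}" using assms by (auto simp: spins_def)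
  fix e assume e: "e \<in> E"
  then have "f e mod int q = g e mod int q" using assms(3) by (simp add: mod_eq_dvd_iff)
  moreover have "f e \<in> {0..<int q}" "g e \<in> {0..<int q}"
    using e assms(1,2) by (auto simp: spins_def)
  ultimately show "f e = g e" by simp
qed

lemma finite_spins: "finite E \<Longrightarrow> finite (spins q E)"
  by (simp add: spins_def finite_PiE)

lemma pairing_reduce_mod: "pairing E a (reduce_mod q E f) mod int q = pairing E a f mod int q"
proof -
  have "(\<Sum>e\<in>E. a e * reduce_mod q E f e) mod int q
      = (\<Sum>e\<in>E. (a e * reduce_mod q E f e) mod int q) mod int q"
    by (simp only: mod_sum_eq)
  also have "\<dots> = (\<Sum>e\<in>E. (a e * f e) mod int q) mod int q"
  proof -
    have "(a e * reduce_mod q E f e) mod int q = (a e * f e) mod int q" if "e \<in> E" for e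
      using that by (simp add: reduce_mod_def mod_mult_right_eq)
    then show ?thesis by simp
  qed
  finally show ?thesis by (simp only: pairing_def mod_sum_eq)
qed

lemma dvd_pairing_reduce_mod:
  "int q dvd pairing E a (reduce_mod q E f) \<longleftrightarrow> int q dvd pairing E a f"
  using pairing_reduce_mod[of E a q f] by (simp add: dvd_eq_mod_eq_0)

text \<open>
  The abstract model: spins in \<open>\<int>/q\<close> sit on the points of \<open>E\<close>, each \<open>c \<in> C\<close> is a linear form
  \<open>L c\<close> on the spins, and a configuration is weighted by \<open>1 + p c\<close> for every form that vanishes
  on it.
\<close>

locale constraint_system =
  fixes q :: nat and E :: "'e set" and C :: "'c set" and L :: "'c \<Rightarrow> 'e \<Rightarrow> int" and p :: "'c \<Rightarrow> real"
  assumes q_pos: "q > 0" and finite_E: "finite E" and finite_C: "finite C"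
    and p_pos: "\<And>c. c \<in> C \<Longrightarrow> p c > 0"
begin

definition solutions :: "'c set \<Rightarrow> ('e \<Rightarrow> int) set" where
  "solutions \<omega> = {f \<in> spins q E. \<forall>c\<in>\<omega>. int q dvd pairing E (L c) f}"

definition weight :: "'c set \<Rightarrow> real" where
  "weight \<omega> = (\<Prod>c\<in>\<omega>. p c) * real (card (solutions \<omega>))"

definition forces :: "'c set \<Rightarrow> ('e \<Rightarrow> int) \<Rightarrow> bool" where
  "forces \<omega> \<gamma> \<longleftrightarrow> (\<forall>f\<in>solutions \<omega>. int q dvd pairing E \<gamma> f)"

definition mass :: "('c set \<Rightarrow> bool) \<Rightarrow> real" where
  "mass Q = (\<Sum>\<omega>\<in>Pow C. of_bool (Q \<omega>) * weight \<omega>)"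

definition forcing_prob :: "('e \<Rightarrow> int) \<Rightarrow> real" where
  "forcing_prob \<gamma> = mass (\<lambda>\<omega>. forces \<omega> \<gamma>) / mass (\<lambda>_. True)"

definition spin_weight :: "('e \<Rightarrow> int) \<Rightarrow> real" where
  "spin_weight f = (\<Prod>c\<in>C. 1 + p c * of_bool (int q dvd pairing E (L c) f))"

definition phase :: "('e \<Rightarrow> int) \<Rightarrow> ('e \<Rightarrow> int) \<Rightarrow> complex" where
  "phase \<gamma> f = cis (2 * pi * of_int (pairing E \<gamma> f) / of_nat q)"

lemma finite_solutions: "finite (solutions \<omega>)"
  using finite_spins[OF finite_E] by (auto simp: solutions_def)

lemma reduce_mod_solutions:
  assumes "\<And>c. c \<in> \<omega> \<Longrightarrow> int q dvd pairing E (L c) f"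
  shows "reduce_mod q E f \<in> solutions \<omega>"
  using assms by (simp add: solutions_def reduce_mod_spins q_pos dvd_pairing_reduce_mod)

text \<open>
  Integer-valued functions are easier to modify than residues, since they can be added without
  reducing; the criterion is insensitive to the choice of representatives.
\<close>

lemma forces_iff:
  "forces \<omega> \<gamma> \<longleftrightarrow>
     (\<forall>f. (\<forall>c\<in>\<omega>. int q dvd pairing E (L c) f) \<longrightarrow> int q dvd pairing E \<gamma> f)"
proof
  assume L: "forces \<omega> \<gamma>"
  show "\<forall>f. (\<forall>c\<in>\<omega>. int q dvd pairing E (L c) f) \<longrightarrow> int q dvd pairing E \<gamma> f"
  proof (intro allI impI)
    fix f assume "\<forall>c\<in>\<omega>. int q dvd pairing E (L c) f"
    then have "reduce_mod q E f \<in> solutions \<omega>" by (intro reduce_mod_solutions) auto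
    with L have "int q dvd pairing E \<gamma> (reduce_mod q E f)" by (simp add: forces_def)
    then show "int q dvd pairing E \<gamma> f" by (simp add: dvd_pairing_reduce_mod)
  qed
qed (auto simp: forces_def solutions_def)

lemma solutions_antimono: "\<omega> \<subseteq> \<omega>' \<Longrightarrow> solutions \<omega>' \<subseteq> solutions \<omega>"
  by (auto simp: solutions_def)

lemma forces_mono: "forces \<omega> \<gamma> \<Longrightarrow> \<omega> \<subseteq> \<omega>' \<Longrightarrow> forces \<omega>' \<gamma>"
  unfolding forces_def using solutions_antimono by blast

lemma card_solutions_pos: "card (solutions \<omega>) > 0"
proof -
  have "reduce_mod q E (\<lambda>_. 0) \<in> solutions \<omega>"
    by (rule reduce_mod_solutions) (simp add: pairing_def)
  then show ?thesis using finite_solutions by (auto simp: card_gt_0_iff)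
qed

lemma weight_pos: "\<omega> \<subseteq> C \<Longrightarrow> weight \<omega> > 0"
  unfolding weight_def using card_solutions_pos p_pos
  by (intro mult_pos_pos prod_pos) (auto simp: subset_iff)

lemma mass_nonneg: "mass Q \<ge> 0"
  unfolding mass_def using weight_pos by (intro sum_nonneg) (simp add: less_imp_le)

lemma mass_ge_weight:
  assumes "\<omega> \<subseteq> C" and "Q \<omega>"
  shows "weight \<omega> \<le> mass Q"
proof -
  have "weight \<omega> = (\<Sum>\<omega>'\<in>{\<omega>}. of_bool (Q \<omega>') * weight \<omega>')" using assms by simp
  also have "\<dots> \<le> mass Q" unfolding mass_def
    using assms finite_C weight_pos by (intro sum_mono2) (auto simp: less_imp_le)
  finally show ?thesis .
qed

lemma mass_True_pos: "mass (\<lambda>_. True) > 0"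
  using mass_ge_weight[of "{}" "\<lambda>_. True"] weight_pos[of "{}"] by simp

text \<open>
  Addition maps \<open>K(\<omega>) \<times> K(\<omega>')\<close> into \<open>K(\<omega> \<inter> \<omega>')\<close>. Two pairs with the same sum differ by an
  element \<open>f - f0 = g0 - g\<close> that lies in both groups, that is, in \<open>K(\<omega> \<union> \<omega>')\<close>.
\<close>

lemma card_solutions_supermodular:
  "card (solutions \<omega>) * card (solutions \<omega>') \<le> card (solutions (\<omega> \<inter> \<omega>')) * card (solutions (\<omega> \<union> \<omega>'))"
proof -
  define \<phi> where "\<phi> = (\<lambda>(f, g). reduce_mod q E (\<lambda>e. f e + g e))"
  have "card (solutions \<omega> \<times> solutions \<omega>') \<le> card (solutions (\<omega> \<inter> \<omega>')) * card (solutions (\<omega> \<union> \<omega>'))"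
  proof (rule card_le_card_mult_fibre_bound[OF finite_solutions finite_solutions])
    show "\<phi> ` (solutions \<omega> \<times> solutions \<omega>') \<subseteq> solutions (\<omega> \<inter> \<omega>')"
    proof clarify
      fix f g assume "f \<in> solutions \<omega>" "g \<in> solutions \<omega>'"
      then show "\<phi> (f, g) \<in> solutions (\<omega> \<inter> \<omega>')"
        unfolding \<phi>_def prod.case
        by (intro reduce_mod_solutions) (auto simp: pairing_add solutions_def)
    qed
    fix a assume a: "a \<in> solutions \<omega> \<times> solutions \<omega>'"
    obtain f0 g0 where fg0: "a = (f0, g0)" by force
    let ?F = "{b \<in> solutions \<omega> \<times> solutions \<omega>'. \<phi> b = \<phi> a}"
    have sum_eq: "int q dvd (f e - f0 e) - (g0 e - g e)" if "(f, g) \<in> ?F" "e \<in> E" for f g e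
      using that reduce_mod_eqD[of q E "\<lambda>e. f e + g e" "\<lambda>e. f0 e + g0 e" e]
      by (simp add: \<phi>_def fg0 algebra_simps)
    have in_both: "reduce_mod q E (\<lambda>e. f e - f0 e) \<in> solutions (\<omega> \<union> \<omega>')" if fg: "(f, g) \<in> ?F" for f g
    proof -
      have eq: "reduce_mod q E (\<lambda>e. f e - f0 e) = reduce_mod q E (\<lambda>e. g0 e - g e)"
        using sum_eq[OF fg] by (auto simp: reduce_mod_def mod_eq_dvd_iff)
      have "int q dvd pairing E (L c) (reduce_mod q E (\<lambda>e. f e - f0 e))" if "c \<in> \<omega> \<union> \<omega>'" for c
      proof (cases "c \<in> \<omega>")
        case True
        then show ?thesis using fg a fg0
          by (simp add: dvd_pairing_reduce_mod pairing_diff solutions_def)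
      next
        case False
        with that have "c \<in> \<omega>'" by simp
        then show ?thesis using fg a fg0
          unfolding eq by (simp add: dvd_pairing_reduce_mod pairing_diff solutions_def)
      qed
      then show ?thesis by (simp add: solutions_def reduce_mod_spins q_pos)
    qed
    have "inj_on (\<lambda>(f, g). reduce_mod q E (\<lambda>e. f e - f0 e)) ?F"
    proof (rule inj_onI, clarify)
      fix f g f' g'
      assume fg: "f \<in> solutions \<omega>" "g \<in> solutions \<omega>'" "\<phi> (f, g) = \<phi> a"
        and fg': "f' \<in> solutions \<omega>" "g' \<in> solutions \<omega>'" "\<phi> (f', g') = \<phi> a"
        and eq: "reduce_mod q E (\<lambda>e. f e - f0 e) = reduce_mod q E (\<lambda>e. f' e - f0 e)"
      have 1: "int q dvd f e - f' e" if "e \<in> E" for e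
        using reduce_mod_eqD[OF eq that] by simp
      have 2: "int q dvd g e - g' e" if "e \<in> E" for e
      proof -
        have "int q dvd ((f e - f0 e) - (g0 e - g e)) - ((f' e - f0 e) - (g0 e - g' e)) - (f e - f' e)"
        proof (rule dvd_diff[OF dvd_diff])
          show "int q dvd (f e - f0 e) - (g0 e - g e)"
            using sum_eq[of f g e] fg that by simp
          show "int q dvd (f' e - f0 e) - (g0 e - g' e)"
            using sum_eq[of f' g' e] fg' that by simp
        qed (rule 1[OF that])
        then show ?thesis by simp
      qed
      show "f = f' \<and> g = g'"
        using 1 2 fg fg' by (auto intro!: spins_eqI simp: solutions_def)
    qed
    moreover have "(\<lambda>(f, g). reduce_mod q E (\<lambda>e. f e - f0 e)) ` ?F \<subseteq> solutions (\<omega> \<union> \<omega>')"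
      using in_both by auto
    ultimately show "\<exists>h. inj_on h ?F \<and> h ` ?F \<subseteq> solutions (\<omega> \<union> \<omega>')" by blast
  qed
  then show ?thesis by (simp add: card_cartesian_product)
qed

text \<open>
  A single extra equation has at most \<open>q\<close> possible right-hand sides, and the solutions for
  a fixed one form a coset of the smaller group.
\<close>

lemma card_solutions_insert: "card (solutions \<omega>) \<le> q * card (solutions (insert c \<omega>))"
proof -
  define \<phi> where "\<phi> f = pairing E (L c) f mod int q" for f
  have "card (solutions \<omega>) \<le> card {0..<int q} * card (solutions (insert c \<omega>))"
  proof (rule card_le_card_mult_fibre_bound[OF _ finite_solutions])
    show "\<phi> ` solutions \<omega> \<subseteq> {0..<int q}" using q_pos by (auto simp: \<phi>_def)
    fix f0 assume f0: "f0 \<in> solutions \<omega>"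
    let ?F = "{f \<in> solutions \<omega>. \<phi> f = \<phi> f0}"
    have "inj_on (\<lambda>f. reduce_mod q E (\<lambda>e. f e - f0 e)) ?F"
    proof (rule inj_onI)
      fix f f' assume f: "f \<in> ?F" "f' \<in> ?F"
        and eq: "reduce_mod q E (\<lambda>e. f e - f0 e) = reduce_mod q E (\<lambda>e. f' e - f0 e)"
      have "int q dvd f e - f' e" if "e \<in> E" for e
        using reduce_mod_eqD[OF eq that] by simp
      then show "f = f'" using f by (auto intro!: spins_eqI simp: solutions_def)
    qed
    moreover have "(\<lambda>f. reduce_mod q E (\<lambda>e. f e - f0 e)) ` ?F \<subseteq> solutions (insert c \<omega>)"
    proof clarify
      fix f assume "f \<in> solutions \<omega>" "\<phi> f = \<phi> f0"
      with f0 show "reduce_mod q E (\<lambda>e. f e - f0 e) \<in> solutions (insert c \<omega>)"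
        by (intro reduce_mod_solutions)
          (auto simp: pairing_diff solutions_def \<phi>_def mod_eq_dvd_iff)
    qed
    ultimately show "\<exists>h. inj_on h ?F \<and> h ` ?F \<subseteq> solutions (insert c \<omega>)" by blast
  qed simp
  then show ?thesis by simp
qed

lemma weight_supermodular:
  assumes "\<omega> \<subseteq> C" and "\<omega>' \<subseteq> C"
  shows "weight \<omega> * weight \<omega>' \<le> weight (\<omega> \<union> \<omega>') * weight (\<omega> \<inter> \<omega>')"
proof -
  have fin: "finite \<omega>" "finite \<omega>'" using assms finite_C finite_subset by blast+
  have prods: "prod p \<omega> * prod p \<omega>' = prod p (\<omega> \<union> \<omega>') * prod p (\<omega> \<inter> \<omega>')"
    using prod.union_inter[OF fin, of p] by simp
  have nonneg: "prod p (\<omega> \<union> \<omega>') * prod p (\<omega> \<inter> \<omega>') \<ge> 0"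
    using assms p_pos by (intro mult_nonneg_nonneg prod_nonneg) (auto simp: subset_iff less_imp_le)
  have "real (card (solutions \<omega>)) * real (card (solutions \<omega>'))
      \<le> real (card (solutions (\<omega> \<inter> \<omega>'))) * real (card (solutions (\<omega> \<union> \<omega>')))"
    using card_solutions_supermodular[of \<omega> \<omega>'] by (simp flip: of_nat_mult)
  from mult_left_mono[OF this nonneg]
  have "(prod p \<omega> * prod p \<omega>') * (real (card (solutions \<omega>)) * real (card (solutions \<omega>')))
      \<le> (prod p (\<omega> \<union> \<omega>') * prod p (\<omega> \<inter> \<omega>'))
         * (real (card (solutions (\<omega> \<inter> \<omega>'))) * real (card (solutions (\<omega> \<union> \<omega>'))))"
    unfolding prods .
  then show ?thesis by (simp only: weight_def mult.assoc mult.left_commute mult.commute)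
qed

text \<open>
  All correlation inequalities used below are instances of this one, by different choices of the events.
\<close>

lemma mass_four_events:
  assumes "\<And>\<omega> \<omega>'. \<omega> \<subseteq> C \<Longrightarrow> \<omega>' \<subseteq> C \<Longrightarrow> Q1 \<omega> \<Longrightarrow> Q2 \<omega>' \<Longrightarrow> Q3 (\<omega> \<union> \<omega>') \<and> Q4 (\<omega> \<inter> \<omega>')"
  shows "mass Q1 * mass Q2 \<le> mass Q3 * mass Q4"
  unfolding mass_def
proof (rule four_functions[OF finite_C])
  fix A B assume "A \<subseteq> C" "B \<subseteq> C"
  then show "of_bool (Q1 A) * weight A * (of_bool (Q2 B) * weight B)
      \<le> of_bool (Q3 (A \<union> B)) * weight (A \<union> B) * (of_bool (Q4 (A \<inter> B)) * weight (A \<inter> B))"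
    using assms[of A B] weight_supermodular[of A B] weight_pos[of "A \<union> B"] weight_pos[of "A \<inter> B"]
    by (auto simp: less_imp_le le_infI1 intro!: mult_nonneg_nonneg)
qed (use weight_pos in \<open>auto simp: less_imp_le\<close>)

lemma mass_forces_both:
  "mass (\<lambda>\<omega>. forces \<omega> \<gamma>) * mass (\<lambda>\<omega>. forces \<omega> \<gamma>')
     \<le> mass (\<lambda>\<omega>. forces \<omega> \<gamma> \<and> forces \<omega> \<gamma>') * mass (\<lambda>_. True)"
  by (rule mass_four_events) (auto intro: forces_mono)

text \<open>
  Orthogonality of characters on the finite group of solutions: if some solution \<open>g\<close> has
  nontrivial phase, translation by \<open>g\<close> multiplies the sum by that phase and leaves it unchanged.
\<close>

lemma sum_phase_solutions:
  "(\<Sum>f\<in>solutions \<omega>. phase \<gamma> f) = (if forces \<omega> \<gamma> then of_nat (card (solutions \<omega>)) else 0)"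
proof (cases "forces \<omega> \<gamma>")
  case True
  have "phase \<gamma> f = 1" if "f \<in> solutions \<omega>" for f
  proof -
    from True that obtain k where k: "pairing E \<gamma> f = int q * k" by (auto simp: forces_def dvd_def)
    have "2 * pi * of_int (pairing E \<gamma> f) / of_nat q = 2 * pi * of_int k"
      using q_pos by (simp add: k)
    then have "phase \<gamma> f = cis (2 * pi * of_int k)" by (simp only: phase_def)
    then show ?thesis by (simp only: cis_multiple_2pi Ints_of_int)
  qed
  with True show ?thesis by simp
next
  case False
  then obtain g where g: "g \<in> solutions \<omega>" "\<not> int q dvd pairing E \<gamma> g" by (auto simp: forces_def)
  define T where "T f = reduce_mod q E (\<lambda>e. f e + g e)" for f
  have phase_cong: "phase \<gamma> f = phase \<gamma> f'" if "pairing E \<gamma> f mod int q = pairing E \<gamma> f' mod int q" for f f'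
  proof -
    from that obtain k where "pairing E \<gamma> f - pairing E \<gamma> f' = int q * k"
      by (auto simp: mod_eq_dvd_iff dvd_def)
    then have k: "pairing E \<gamma> f = pairing E \<gamma> f' + int q * k" by simp
    have "2 * pi * of_int (pairing E \<gamma> f) / of_nat q
        = 2 * pi * of_int (pairing E \<gamma> f') / of_nat q + 2 * pi * of_int k"
      using q_pos by (simp add: k field_simps)
    then show ?thesis by (simp add: phase_def cis_multiple_2pi flip: cis_mult)
  qed
  have T_in: "T f \<in> solutions \<omega>" if "f \<in> solutions \<omega>" for f
    unfolding T_def using that g by (intro reduce_mod_solutions) (auto simp: pairing_add solutions_def)
  have "inj_on T (solutions \<omega>)"
  proof (rule inj_onI)
    fix f f' assume f: "f \<in> solutions \<omega>" "f' \<in> solutions \<omega>" "T f = T f'"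
    have "int q dvd f e - f' e" if "e \<in> E" for e
      using reduce_mod_eqD[OF f(3)[unfolded T_def] that] by simp
    then show "f = f'" using f by (auto intro!: spins_eqI simp: solutions_def)
  qed
  then have bij: "bij_betw T (solutions \<omega>) (solutions \<omega>)"
    using T_in finite_solutions by (simp add: bij_betw_def endo_inj_surj image_subset_iff)
  have "(\<Sum>f\<in>solutions \<omega>. phase \<gamma> f) = (\<Sum>f\<in>solutions \<omega>. phase \<gamma> (T f))"
    using sum.reindex_bij_betw[OF bij, of "phase \<gamma>"] by simp
  also have "\<dots> = (\<Sum>f\<in>solutions \<omega>. phase \<gamma> f * phase \<gamma> g)"
  proof (rule sum.cong[OF refl])
    fix f
    have "phase \<gamma> (T f) = phase \<gamma> (\<lambda>e. f e + g e)"
      by (rule phase_cong) (simp add: T_def pairing_reduce_mod)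
    then show "phase \<gamma> (T f) = phase \<gamma> f * phase \<gamma> g"
      by (simp add: phase_def pairing_add cis_mult add_divide_distrib distrib_left)
  qed
  also have "\<dots> = (\<Sum>f\<in>solutions \<omega>. phase \<gamma> f) * phase \<gamma> g" by (simp add: sum_distrib_right)
  finally have *: "(\<Sum>f\<in>solutions \<omega>. phase \<gamma> f) * (1 - phase \<gamma> g) = 0" by (simp add: algebra_simps)
  have "phase \<gamma> g \<noteq> 1"
  proof
    assume "phase \<gamma> g = 1"
    then have "cos (2 * pi * of_int (pairing E \<gamma> g) / of_nat q) = 1"
      by (simp add: phase_def complex_eq_iff)
    then obtain k :: int where "2 * pi * of_int (pairing E \<gamma> g) / of_nat q = of_int k * 2 * pi"
      using cos_one_2pi_int by blast
    then have "of_int (pairing E \<gamma> g) = (of_int (k * int q) :: real)"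
      using q_pos by (simp add: field_simps)
    then have "pairing E \<gamma> g = k * int q" by (simp only: of_int_eq_iff)
    with g(2) show False by simp
  qed
  with * False show ?thesis by simp
qed

lemma prod_one_plus:
  fixes g :: "'c \<Rightarrow> 'b :: comm_semiring_1"
  assumes "finite S"
  shows "(\<Prod>c\<in>S. 1 + g c) = (\<Sum>\<omega>\<in>Pow S. \<Prod>c\<in>\<omega>. g c)"
  using assms
proof (induction S rule: finite_induct)
  case (insert c S)
  have "(\<Prod>x\<in>insert c A. g x) = g c * (\<Prod>x\<in>A. g x)" if "A \<in> Pow S" for A
    using that insert.hyps finite_subset[of A S] by (subst prod.insert) auto
  then show ?case
    using insert by (simp add: sum_Pow_insert sum_distrib_left distrib_left distrib_right sum.distrib)
qed simp

text \<open>
  Expand the product in the spin weight over the set \<open>\<omega>\<close> of factors from which the second summand is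
  taken, and exchange the sums: the inner sum is a character sum over the solutions.
\<close>

lemma random_cluster_expansion:
  "(\<Sum>f\<in>spins q E. complex_of_real (spin_weight f) * phase \<gamma> f)
     = of_real (mass (\<lambda>\<omega>. forces \<omega> \<gamma>))"
proof -
  have "complex_of_real (spin_weight f)
      = (\<Sum>\<omega>\<in>Pow C. of_real (\<Prod>c\<in>\<omega>. p c) * of_bool (\<forall>c\<in>\<omega>. int q dvd pairing E (L c) f))" for f
  proof -
    have "(\<Prod>c\<in>\<omega>. p c * of_bool (int q dvd pairing E (L c) f))
        = (\<Prod>c\<in>\<omega>. p c) * of_bool (\<forall>c\<in>\<omega>. int q dvd pairing E (L c) f)" if "\<omega> \<in> Pow C" for \<omega>
      using that finite_C finite_subset[of \<omega> C] by (auto simp: prod.distrib)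
    then have "spin_weight f = (\<Sum>\<omega>\<in>Pow C. (\<Prod>c\<in>\<omega>. p c) * of_bool (\<forall>c\<in>\<omega>. int q dvd pairing E (L c) f))"
      by (simp add: spin_weight_def prod_one_plus[OF finite_C])
    then show ?thesis by (simp add: of_bool_def if_distrib cong: if_cong)
  qed
  then have "(\<Sum>f\<in>spins q E. complex_of_real (spin_weight f) * phase \<gamma> f)
      = (\<Sum>f\<in>spins q E. \<Sum>\<omega>\<in>Pow C. of_real (\<Prod>c\<in>\<omega>. p c) *
           (of_bool (\<forall>c\<in>\<omega>. int q dvd pairing E (L c) f) * phase \<gamma> f))"
    by (simp add: sum_distrib_right mult.assoc)
  also have "\<dots> = (\<Sum>\<omega>\<in>Pow C. of_real (\<Prod>c\<in>\<omega>. p c) *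
      (\<Sum>f\<in>spins q E. of_bool (\<forall>c\<in>\<omega>. int q dvd pairing E (L c) f) * phase \<gamma> f))"
    by (subst sum.swap) (simp add: sum_distrib_left)
  also have "\<dots> = (\<Sum>\<omega>\<in>Pow C. of_real (\<Prod>c\<in>\<omega>. p c) * (\<Sum>f\<in>solutions \<omega>. phase \<gamma> f))"
    unfolding solutions_def
    by (intro sum.cong refl arg_cong[where f = "(*) _"] sum.mono_neutral_cong_right finite_spins finite_E) auto
  also have "\<dots> = of_real (mass (\<lambda>\<omega>. forces \<omega> \<gamma>))"
    unfolding sum_phase_solutions mass_def weight_def of_real_sum by (intro sum.cong refl) simp
  finally show ?thesis .
qed

lemma expectation_phase:
  "(\<Sum>f\<in>spins q E. complex_of_real (spin_weight f / (\<Sum>g\<in>spins q E. spin_weight g)) * phase \<gamma> f)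
     = of_real (forcing_prob \<gamma>)"
proof -
  have "phase (\<lambda>_. 0) f = 1" for f by (simp add: phase_def pairing_def)
  moreover have "forces \<omega> (\<lambda>_. 0)" for \<omega> by (simp add: forces_def pairing_def)
  ultimately have "complex_of_real (\<Sum>g\<in>spins q E. spin_weight g) = of_real (mass (\<lambda>_. True))"
    using random_cluster_expansion[of "\<lambda>_. 0"] by simp
  then have Z: "(\<Sum>g\<in>spins q E. spin_weight g) = mass (\<lambda>_. True)" by (simp only: of_real_eq_iff)
  show ?thesis
    unfolding Z forcing_prob_def of_real_divide random_cluster_expansion[symmetric]
    by (simp add: sum_divide_distrib)
qed

end

section \<open>Local surgery\<close>

context constraint_system
begin

lemma weight_toggle:
  assumes "\<omega> \<subseteq> C" and "c \<in> C" and "K \<ge> 1" and "p c \<le> K" and "real q / p c \<le> K"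
  shows "weight (insert c \<omega>) \<le> K * weight \<omega>" and "weight (\<omega> - {c}) \<le> K * weight \<omega>"
proof -
  have pc: "p c > 0" using assms p_pos by blast
  have remove: "weight \<omega>' \<le> K * weight (insert c \<omega>')"
    and add: "weight (insert c \<omega>') \<le> K * weight \<omega>'" if "\<omega>' \<subseteq> C" "c \<notin> \<omega>'" for \<omega>'
  proof -
    have fin: "finite \<omega>'" using that finite_C finite_subset by blast
    have prods: "(\<Prod>c\<in>\<omega>'. p c) \<ge> 0" using that p_pos by (intro prod_nonneg) (auto simp: less_imp_le)
    have "real (card (solutions \<omega>')) \<le> real q * real (card (solutions (insert c \<omega>')))"
      using card_solutions_insert[of \<omega>' c] by (simp flip: of_nat_mult)
    also have "\<dots> \<le> (K * p c) * real (card (solutions (insert c \<omega>')))"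
      using assms(5) pc by (intro mult_right_mono) (simp_all add: field_simps)
    finally have "real (card (solutions \<omega>')) \<le> (K * p c) * real (card (solutions (insert c \<omega>')))" .
    from mult_left_mono[OF this prods] show "weight \<omega>' \<le> K * weight (insert c \<omega>')"
      using fin that by (simp add: weight_def mult_ac)
    have "card (solutions (insert c \<omega>')) \<le> card (solutions \<omega>')"
      by (intro card_mono finite_solutions solutions_antimono) auto
    then have "p c * real (card (solutions (insert c \<omega>'))) \<le> K * real (card (solutions \<omega>'))"
      using assms(3,4) pc by (intro mult_mono) auto
    from mult_left_mono[OF this prods] show "weight (insert c \<omega>') \<le> K * weight \<omega>'"
      using fin that by (simp add: weight_def mult_ac)
  qed
  have stay: "weight \<omega> \<le> K * weight \<omega>"
    using weight_pos[OF assms(1)] assms(3) by simp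
  show "weight (insert c \<omega>) \<le> K * weight \<omega>"
    using stay add[OF assms(1)] by (cases "c \<in> \<omega>") (simp_all add: insert_absorb)
  show "weight (\<omega> - {c}) \<le> K * weight \<omega>"
  proof (cases "c \<in> \<omega>")
    case True
    then show ?thesis using remove[of "\<omega> - {c}"] assms(1) by (auto simp: insert_absorb)
  qed (use stay in simp)
qed

lemma weight_local_change:
  assumes "finite D" and "D \<subseteq> C" and "\<omega> \<subseteq> C" and "\<omega>' \<subseteq> C" and "\<omega> - D = \<omega>' - D"
    and "K \<ge> 1" and "\<And>c. c \<in> C \<Longrightarrow> p c \<le> K" and "\<And>c. c \<in> C \<Longrightarrow> real q / p c \<le> K"
  shows "weight \<omega> \<le> K ^ card D * weight \<omega>'"
  using assms(1-5)
proof (induction D arbitrary: \<omega>' rule: finite_induct)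
  case (insert c D)
  define \<omega>'' where "\<omega>'' = (if c \<in> \<omega> then insert c \<omega>' else \<omega>' - {c})"
  have c: "c \<in> C" using insert.prems by auto
  have "weight \<omega> \<le> K ^ card D * weight \<omega>''"
    using insert.prems insert.hyps by (intro insert.IH) (auto simp: \<omega>''_def)
  also have "\<dots> \<le> K ^ card D * (K * weight \<omega>')"
    using weight_toggle[OF insert.prems(3) c assms(6) assms(7,8)[OF c]] assms(6)
    by (intro mult_left_mono) (auto simp: \<omega>''_def)
  finally show ?case using insert.hyps by (simp add: mult_ac)
qed simp

lemma mass_eq_sum: "mass Q = (\<Sum>\<omega>\<in>{\<omega> \<in> Pow C. Q \<omega>}. weight \<omega>)"
  unfolding mass_def using finite_C
  by (intro sum.mono_neutral_cong_right) auto

text \<open>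
  A multi-valued map principle. Each configuration of \<open>Q\<close> is changed at each location \<open>x \<in> J\<close>.
  For fixed \<open>x\<close> at most \<open>2 ^ B\<close> configurations share an image and each loses at most a factor
  \<open>K ^ B\<close> of weight; for different \<open>x\<close> the images are disjoint. So the images have
  total mass at least \<open>card J\<close> times a constant times the mass of \<open>Q\<close>.
\<close>

lemma mass_surgery:
  fixes star D :: "'j \<Rightarrow> 'c set"
  assumes "finite J" and "K \<ge> 1"
    and K: "\<And>c. c \<in> C \<Longrightarrow> p c \<le> K" "\<And>c. c \<in> C \<Longrightarrow> real q / p c \<le> K"
    and D: "\<And>x. x \<in> J \<Longrightarrow> star x \<subseteq> D x \<and> D x \<subseteq> C \<and> card (D x) \<le> B"
    and disj: "\<And>x y. x \<in> J \<Longrightarrow> y \<in> J \<Longrightarrow> x \<noteq> y \<Longrightarrow> star x \<inter> star y = {}"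
    and hit: "\<And>x \<omega>. x \<in> J \<Longrightarrow> \<omega> \<subseteq> C \<Longrightarrow> Q \<omega> \<Longrightarrow> star x \<inter> \<omega> \<noteq> {}"
    and repair: "\<And>x \<omega>. x \<in> J \<Longrightarrow> \<omega> \<subseteq> C \<Longrightarrow> Q \<omega> \<Longrightarrow> Q' ((\<omega> \<union> D x) - star x)"
  shows "real (card J) * mass Q \<le> (2 * K) ^ B * mass Q'"
proof -
  define G where "G = {\<omega> \<in> Pow C. Q \<omega>}"
  define \<Phi> where "\<Phi> x \<omega> = (\<omega> \<union> D x) - star x" for x \<omega>
  have finG: "finite G" using finite_C by (simp add: G_def)
  have D_fin: "finite (D x)" if "x \<in> J" for x using D[OF that] finite_C finite_subset by blast
  have \<Phi>_sub: "\<Phi> x \<omega> \<subseteq> C" if "x \<in> J" "\<omega> \<in> G" for x \<omega>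
    using that D[OF that(1)] by (auto simp: \<Phi>_def G_def)
  have w_nonneg: "weight (\<Phi> x \<omega>) \<ge> 0" if "x \<in> J" "\<omega> \<in> G" for x \<omega>
    using weight_pos[OF \<Phi>_sub[OF that]] by simp
  have one: "mass Q \<le> (2 * K) ^ B * (\<Sum>\<eta>\<in>\<Phi> x ` G. weight \<eta>)" if x: "x \<in> J" for x
  proof -
    have "weight \<omega> \<le> K ^ B * weight (\<Phi> x \<omega>)" if \<omega>: "\<omega> \<in> G" for \<omega>
    proof -
      have "weight \<omega> \<le> K ^ card (D x) * weight (\<Phi> x \<omega>)"
        using \<omega> D[OF x] D_fin[OF x] \<Phi>_sub[OF x \<omega>] assms(2) K
        by (intro weight_local_change) (auto simp: G_def \<Phi>_def)
      also have "\<dots> \<le> K ^ B * weight (\<Phi> x \<omega>)"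
        using D[OF x] assms(2) w_nonneg[OF x \<omega>] by (intro mult_right_mono power_increasing) auto
      finally show ?thesis .
    qed
    then have "mass Q \<le> (\<Sum>\<omega>\<in>G. K ^ B * weight (\<Phi> x \<omega>))"
      unfolding mass_eq_sum G_def[symmetric] by (rule sum_mono)
    also have "\<dots> = K ^ B * (\<Sum>\<omega>\<in>G. weight (\<Phi> x \<omega>))" by (simp add: sum_distrib_left)
    also have "(\<Sum>\<omega>\<in>G. weight (\<Phi> x \<omega>))
        = (\<Sum>\<eta>\<in>\<Phi> x ` G. real (card {\<omega> \<in> G. \<Phi> x \<omega> = \<eta>}) * weight \<eta>)"
      by (subst sum.image_gen[OF finG, of _ "\<Phi> x"]) (intro sum.cong refl, simp)
    also have "K ^ B * \<dots> \<le> K ^ B * (\<Sum>\<eta>\<in>\<Phi> x ` G. 2 ^ B * weight \<eta>)"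
    proof (intro mult_left_mono sum_mono mult_right_mono)
      fix \<eta> assume "\<eta> \<in> \<Phi> x ` G"
      then show "weight \<eta> \<ge> 0" using w_nonneg[OF x] by auto
      \<comment> \<open>Outside \<open>D x\<close> nothing changes, so the lost information is a subset of \<open>D x\<close>.\<close>
      have "inj_on (\<lambda>\<omega>. \<omega> \<inter> D x) {\<omega> \<in> G. \<Phi> x \<omega> = \<eta>}"
      proof (rule inj_onI)
        fix \<omega> \<omega>' assume *: "\<omega> \<in> {\<omega> \<in> G. \<Phi> x \<omega> = \<eta>}" "\<omega>' \<in> {\<omega> \<in> G. \<Phi> x \<omega> = \<eta>}"
          "\<omega> \<inter> D x = \<omega>' \<inter> D x"
        have "\<omega> - D x = \<eta> - D x" "\<omega>' - D x = \<eta> - D x"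
          using * D[OF x] by (auto simp: \<Phi>_def)
        with *(3) show "\<omega> = \<omega>'" by blast
      qed
      then have "card {\<omega> \<in> G. \<Phi> x \<omega> = \<eta>} \<le> card (Pow (D x))"
        using D_fin[OF x] by (intro card_inj_on_le) auto
      also have "\<dots> \<le> 2 ^ B"
        using D[OF x] D_fin[OF x] by (simp add: card_Pow power_increasing)
      finally show "real (card {\<omega> \<in> G. \<Phi> x \<omega> = \<eta>}) \<le> 2 ^ B"
        by (metis of_nat_le_iff of_nat_numeral of_nat_power)
    qed (use assms(2) in simp)
    also have "\<dots> = (2 * K) ^ B * (\<Sum>\<eta>\<in>\<Phi> x ` G. weight \<eta>)"
      by (simp add: power_mult_distrib sum_distrib_left mult_ac)
    finally show ?thesis .
  qed
  have "real (card J) * mass Q = (\<Sum>x\<in>J. mass Q)" by simp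
  also have "\<dots> \<le> (\<Sum>x\<in>J. (2 * K) ^ B * (\<Sum>\<eta>\<in>\<Phi> x ` G. weight \<eta>))"
    by (rule sum_mono) (rule one)
  also have "\<dots> = (2 * K) ^ B * (\<Sum>x\<in>J. \<Sum>\<eta>\<in>\<Phi> x ` G. weight \<eta>)"
    by (simp add: sum_distrib_left)
  also have "(\<Sum>x\<in>J. \<Sum>\<eta>\<in>\<Phi> x ` G. weight \<eta>) = (\<Sum>\<eta>\<in>(\<Union>x\<in>J. \<Phi> x ` G). weight \<eta>)"
  proof (rule sum.UNION_disjoint[symmetric])
    \<comment> \<open>The location of the surgery can be read off: it is the only \<open>x\<close> whose star has no open element.\<close>
    show "\<forall>x\<in>J. \<forall>y\<in>J. x \<noteq> y \<longrightarrow> \<Phi> x ` G \<inter> \<Phi> y ` G = {}"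
    proof (intro ballI impI)
      fix x y assume xy: "x \<in> J" "y \<in> J" "x \<noteq> y"
      have "star y \<inter> \<Phi> x \<omega> \<noteq> {}" if "\<omega> \<in> G" for \<omega>
        using hit[OF xy(2), of \<omega>] disj[OF xy] that by (auto simp: \<Phi>_def G_def)
      moreover have "star y \<inter> \<Phi> y \<omega> = {}" for \<omega> by (auto simp: \<Phi>_def)
      ultimately show "\<Phi> x ` G \<inter> \<Phi> y ` G = {}" by force
    qed
  qed (use assms(1) finG in auto)
  also have "(2 * K) ^ B * \<dots> \<le> (2 * K) ^ B * mass Q'"
  proof (intro mult_left_mono)
    have "(\<Union>x\<in>J. \<Phi> x ` G) \<subseteq> {\<omega> \<in> Pow C. Q' \<omega>}"
    proof clarify
      fix x \<omega> assume "x \<in> J" "\<omega> \<in> G"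
      then show "\<Phi> x \<omega> \<in> Pow C \<and> Q' (\<Phi> x \<omega>)"
        using repair[of x \<omega>] \<Phi>_sub[of x \<omega>] by (auto simp: G_def \<Phi>_def[of x \<omega>])
    qed
    then show "(\<Sum>\<eta>\<in>(\<Union>x\<in>J. \<Phi> x ` G). weight \<eta>) \<le> mass Q'"
      unfolding mass_eq_sum using finite_C weight_pos by (intro sum_mono2) (auto simp: less_imp_le)
  qed (use assms(2) in simp)
  finally show ?thesis .
qed

text \<open>
  Positive association turns a bound on the joint event into a bound on the product.
\<close>

lemma forcing_prob_mult_le:
  assumes "real n * mass (\<lambda>\<omega>. forces \<omega> \<gamma> \<and> forces \<omega> \<gamma>') \<le> M * mass (\<lambda>\<omega>. forces \<omega> \<gamma>'')"
  shows "real n * (forcing_prob \<gamma> * forcing_prob \<gamma>') \<le> M * forcing_prob \<gamma>''"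
proof -
  let ?Z = "mass (\<lambda>_. True)"
  have "real n * (mass (\<lambda>\<omega>. forces \<omega> \<gamma>) * mass (\<lambda>\<omega>. forces \<omega> \<gamma>'))
      \<le> (real n * mass (\<lambda>\<omega>. forces \<omega> \<gamma> \<and> forces \<omega> \<gamma>')) * ?Z"
    using mult_left_mono[OF mass_forces_both[of \<gamma> \<gamma>'], of "real n"] by (simp add: mult_ac)
  also have "\<dots> \<le> (M * mass (\<lambda>\<omega>. forces \<omega> \<gamma>'')) * ?Z"
    using assms mass_nonneg by (intro mult_right_mono) auto
  finally show ?thesis
    using mass_True_pos by (simp add: forcing_prob_def field_simps power2_eq_square)
qed

end

section \<open>Embeddings of constraint systems\<close>

text \<open>
  A system contained in a larger one up to relabelling and up to signs, such that the image
  constraints involve the image spins only. Signs are needed for reflections of the lattice, which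
  reverse the orientation of some cells.
\<close>

locale constraint_embedding =
  dom: constraint_system q E C L p + cod: constraint_system q E' C' L' p'
  for q and E :: "'e set" and C :: "'c set" and L p and E' :: "'f set" and C' :: "'d set" and L' p' +
  fixes \<phi> :: "'e \<Rightarrow> 'f" and \<psi> :: "'c \<Rightarrow> 'd" and s :: "'e \<Rightarrow> int" and t :: "'c \<Rightarrow> int"
  assumes inj_\<phi>: "inj_on \<phi> E" and \<phi>_sub: "\<phi> ` E \<subseteq> E'"
    and inj_\<psi>: "inj_on \<psi> C" and \<psi>_sub: "\<psi> ` C \<subseteq> C'"
    and s_sign: "\<And>e. e \<in> E \<Longrightarrow> s e = 1 \<or> s e = -1"
    and t_sign: "\<And>c. c \<in> C \<Longrightarrow> t c = 1 \<or> t c = -1"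
    and L'_image: "\<And>c e. c \<in> C \<Longrightarrow> e \<in> E \<Longrightarrow> L' (\<psi> c) (\<phi> e) = t c * s e * L c e"
    and L'_off: "\<And>c e'. c \<in> C \<Longrightarrow> e' \<in> E' - \<phi> ` E \<Longrightarrow> L' (\<psi> c) e' = 0"
    and p'_image: "\<And>c. c \<in> C \<Longrightarrow> p' (\<psi> c) = p c"
begin

lemma s_square: "e \<in> E \<Longrightarrow> s e * (s e * x) = x"
  using s_sign[of e] by auto

definition pull :: "('f \<Rightarrow> int) \<Rightarrow> 'e \<Rightarrow> int" where
  "pull f = (\<lambda>e. s e * f (\<phi> e))"

lemma pairing_pull:
  assumes "\<And>e. e \<in> E \<Longrightarrow> a' (\<phi> e) = u * s e * a e" and "\<And>e'. e' \<in> E' - \<phi> ` E \<Longrightarrow> a' e' = 0"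
  shows "pairing E' a' f = u * pairing E a (pull f)"
proof -
  have "pairing E' a' f = (\<Sum>e'\<in>\<phi> ` E. a' e' * f e')"
    unfolding pairing_def using \<phi>_sub assms(2) cod.finite_E by (intro sum.mono_neutral_right) auto
  also have "\<dots> = (\<Sum>e\<in>E. a' (\<phi> e) * f (\<phi> e))"
    using inj_\<phi> by (simp add: sum.reindex)
  finally show ?thesis
    using assms(1) by (simp add: pairing_def pull_def sum_distrib_left mult_ac)
qed

lemma dvd_pairing_pull:
  assumes "c \<in> C"
  shows "int q dvd pairing E' (L' (\<psi> c)) f \<longleftrightarrow> int q dvd pairing E (L c) (pull f)"
proof -
  have "pairing E' (L' (\<psi> c)) f = t c * pairing E (L c) (pull f)"
    by (rule pairing_pull) (use assms L'_image L'_off in auto)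
  then show ?thesis using t_sign[OF assms] by auto
qed

definition push :: "('e \<Rightarrow> int) \<Rightarrow> ('f \<Rightarrow> int) \<Rightarrow> 'f \<Rightarrow> int" where
  "push f r = (\<lambda>e'. if e' \<in> \<phi> ` E then s (inv_into E \<phi> e') * f (inv_into E \<phi> e') else r e')"

lemma push_image: "e \<in> E \<Longrightarrow> push f r (\<phi> e) = s e * f e"
  using inj_\<phi> by (simp add: push_def)

lemma pairing_pull_push: "pairing E a (pull (push f r)) = pairing E a f"
  unfolding pairing_def by (intro sum.cong refl) (simp add: pull_def push_image s_square)

lemma forces_image_iff:
  assumes "\<omega> \<subseteq> C" and "u = 1 \<or> u = -1" and "\<And>e. e \<in> E \<Longrightarrow> \<gamma>' (\<phi> e) = u * s e * \<gamma> e"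
    and "\<And>e'. e' \<in> E' - \<phi> ` E \<Longrightarrow> \<gamma>' e' = 0"
  shows "cod.forces (\<psi> ` \<omega>) \<gamma>' \<longleftrightarrow> dom.forces \<omega> \<gamma>"
proof -
  have constraints: "(\<forall>c'\<in>\<psi> ` \<omega>. int q dvd pairing E' (L' c') f)
      \<longleftrightarrow> (\<forall>c\<in>\<omega>. int q dvd pairing E (L c) (pull f))" for f
    using assms(1) dvd_pairing_pull by auto
  have target: "int q dvd pairing E' \<gamma>' f \<longleftrightarrow> int q dvd pairing E \<gamma> (pull f)" for f
  proof -
    have "pairing E' \<gamma>' f = u * pairing E \<gamma> (pull f)"
      by (rule pairing_pull) (use assms(3,4) in auto)
    then show ?thesis using assms(2) by auto
  qed
  show ?thesis
    unfolding cod.forces_iff dom.forces_iff constraints target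
  proof (intro iffI allI impI)
    fix f
    assume all: "\<forall>f. (\<forall>c\<in>\<omega>. int q dvd pairing E (L c) (pull f)) \<longrightarrow> int q dvd pairing E \<gamma> (pull f)"
      and sat: "\<forall>c\<in>\<omega>. int q dvd pairing E (L c) f"
    show "int q dvd pairing E \<gamma> f"
      using spec[OF all, of "push f (\<lambda>_. 0)"] sat by (simp add: pairing_pull_push)
  qed auto
qed

text \<open>
  The spins outside the image are unconstrained, and contribute a factor that does not depend
  on \<open>\<omega>\<close>.
\<close>

lemma card_solutions_image:
  assumes "\<omega> \<subseteq> C"
  shows "card (cod.solutions (\<psi> ` \<omega>)) = card (dom.solutions \<omega>) * card (spins q (E' - \<phi> ` E))"
proof -
  define F where "F f = (reduce_mod q E (pull f), reduce_mod q (E' - \<phi> ` E) f)" for f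
  define G where "G = (\<lambda>(f, r). reduce_mod q E' (push f r))"
  have mod_dvd: "int q dvd x mod int q - x" "int q dvd x - x mod int q" for x :: int
    by (simp_all add: mod_eq_dvd_iff[symmetric])
  have push_in: "push f r e' = r e'" if "e' \<in> E' - \<phi> ` E" for f r e'
    using that by (simp add: push_def)
  have sat: "(\<forall>c'\<in>\<psi> ` \<omega>. int q dvd pairing E' (L' c') f)
      \<longleftrightarrow> (\<forall>c\<in>\<omega>. int q dvd pairing E (L c) (pull f))" for f
    using assms dvd_pairing_pull by auto
  have "bij_betw F (cod.solutions (\<psi> ` \<omega>)) (dom.solutions \<omega> \<times> spins q (E' - \<phi> ` E))"
  proof (rule bij_betw_byWitness[where f' = G])
    show "\<forall>f\<in>cod.solutions (\<psi> ` \<omega>). G (F f) = f"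
    proof
      fix f assume f: "f \<in> cod.solutions (\<psi> ` \<omega>)"
      show "G (F f) = f"
      proof (rule spins_eqI)
        show "G (F f) \<in> spins q E'" by (simp add: G_def F_def reduce_mod_spins dom.q_pos)
        show "f \<in> spins q E'" using f by (simp add: cod.solutions_def)
        fix e' assume e': "e' \<in> E'"
        show "int q dvd G (F f) e' - f e'"
        proof (cases "e' \<in> \<phi> ` E")
          case True
          then obtain e where e: "e \<in> E" "e' = \<phi> e" by auto
          have "(s e * (s e * f e' mod int q)) mod int q = f e' mod int q"
            by (simp only: mod_mult_right_eq s_square[OF e(1)])
          then show ?thesis
            using e e' by (simp add: G_def F_def reduce_mod_def push_image pull_def mod_eq_dvd_iff[symmetric])
        next
          case False
          then show ?thesis
            using e' by (simp add: G_def F_def reduce_mod_def push_in mod_dvd)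
        qed
      qed
    qed
    show "\<forall>a\<in>dom.solutions \<omega> \<times> spins q (E' - \<phi> ` E). F (G a) = a"
    proof clarify
      fix f r assume f: "f \<in> dom.solutions \<omega>" and r: "r \<in> spins q (E' - \<phi> ` E)"
      have "reduce_mod q E (pull (G (f, r))) = f"
      proof (rule spins_eqI)
        show "reduce_mod q E (pull (G (f, r))) \<in> spins q E" by (simp add: reduce_mod_spins dom.q_pos)
        show "f \<in> spins q E" using f by (simp add: dom.solutions_def)
        fix e assume e: "e \<in> E"
        then have e': "\<phi> e \<in> E'" using \<phi>_sub by auto
        have "(s e * (s e * f e mod int q)) mod int q = f e mod int q"
          by (simp only: mod_mult_right_eq s_square[OF e])
        then show "int q dvd reduce_mod q E (pull (G (f, r))) e - f e"
          using e e' by (simp add: G_def reduce_mod_def push_image pull_def mod_eq_dvd_iff[symmetric])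
      qed
      moreover have "reduce_mod q (E' - \<phi> ` E) (G (f, r)) = r"
      proof (rule spins_eqI)
        show "reduce_mod q (E' - \<phi> ` E) (G (f, r)) \<in> spins q (E' - \<phi> ` E)"
          by (simp add: reduce_mod_spins dom.q_pos)
        show "int q dvd reduce_mod q (E' - \<phi> ` E) (G (f, r)) e - r e" if "e \<in> E' - \<phi> ` E" for e
          using that by (simp add: G_def reduce_mod_def push_in mod_dvd)
      qed (rule r)
      ultimately show "F (G (f, r)) = (f, r)" by (simp add: F_def)
    qed
    show "F ` cod.solutions (\<psi> ` \<omega>) \<subseteq> dom.solutions \<omega> \<times> spins q (E' - \<phi> ` E)"
    proof
      fix y assume "y \<in> F ` cod.solutions (\<psi> ` \<omega>)"
      then obtain f where f: "f \<in> cod.solutions (\<psi> ` \<omega>)" "y = F f" by auto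
      have "reduce_mod q E (pull f) \<in> dom.solutions \<omega>"
        using f(1) sat[of f] by (intro dom.reduce_mod_solutions) (auto simp: cod.solutions_def)
      then show "y \<in> dom.solutions \<omega> \<times> spins q (E' - \<phi> ` E)"
        by (simp add: f(2) F_def reduce_mod_spins dom.q_pos)
    qed
    show "G ` (dom.solutions \<omega> \<times> spins q (E' - \<phi> ` E)) \<subseteq> cod.solutions (\<psi> ` \<omega>)"
    proof clarify
      fix f r assume f: "f \<in> dom.solutions \<omega>"
      have "\<forall>c'\<in>\<psi> ` \<omega>. int q dvd pairing E' (L' c') (push f r)"
        using f unfolding sat by (simp add: pairing_pull_push dom.solutions_def)
      then show "G (f, r) \<in> cod.solutions (\<psi> ` \<omega>)"
        unfolding G_def prod.case by (intro cod.reduce_mod_solutions) auto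
    qed
  qed
  then show ?thesis by (simp add: bij_betw_same_card card_cartesian_product)
qed

lemma weight_image:
  assumes "\<omega> \<subseteq> C"
  shows "cod.weight (\<psi> ` \<omega>) = dom.weight \<omega> * card (spins q (E' - \<phi> ` E))"
proof -
  have "inj_on \<psi> \<omega>" using inj_\<psi> assms inj_on_subset by blast
  then have "(\<Prod>c\<in>\<psi> ` \<omega>. p' c) = (\<Prod>c\<in>\<omega>. p c)"
    using assms p'_image by (auto simp: prod.reindex intro!: prod.cong)
  then show ?thesis
    by (simp add: cod.weight_def dom.weight_def card_solutions_image[OF assms])
qed

lemma mass_image:
  assumes "\<And>\<omega>. \<omega> \<subseteq> C \<Longrightarrow> Q' (\<psi> ` \<omega>) \<longleftrightarrow> Q \<omega>"
  shows "cod.mass (\<lambda>\<omega>. \<omega> \<subseteq> \<psi> ` C \<and> Q' \<omega>) = dom.mass Q * card (spins q (E' - \<phi> ` E))"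
proof -
  have inj: "inj_on ((`) \<psi>) (Pow C)" using inj_\<psi> by (rule inj_on_image_Pow)
  have "cod.mass (\<lambda>\<omega>. \<omega> \<subseteq> \<psi> ` C \<and> Q' \<omega>) = (\<Sum>\<omega>\<in>Pow (\<psi> ` C). of_bool (Q' \<omega>) * cod.weight \<omega>)"
    unfolding cod.mass_def using \<psi>_sub cod.finite_C by (intro sum.mono_neutral_cong_right) auto
  also have "Pow (\<psi> ` C) = (`) \<psi> ` Pow C" by (rule image_Pow_surj[symmetric]) simp
  also have "(\<Sum>\<omega>\<in>(`) \<psi> ` Pow C. of_bool (Q' \<omega>) * cod.weight \<omega>)
      = (\<Sum>\<omega>\<in>Pow C. of_bool (Q \<omega>) * (dom.weight \<omega> * card (spins q (E' - \<phi> ` E))))"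
    unfolding sum.reindex[OF inj] o_def
    by (intro sum.cong refl) (simp add: assms weight_image)
  finally show ?thesis by (simp only: dom.mass_def sum_distrib_right mult.assoc)
qed

text \<open>
  The small system is the large one conditioned on all constraints outside the image being
  closed. This is a decreasing event, and forcing is increasing.
\<close>

lemma forcing_prob_le:
  assumes "u = 1 \<or> u = -1" and "\<And>e. e \<in> E \<Longrightarrow> \<gamma>' (\<phi> e) = u * s e * \<gamma> e"
    and "\<And>e'. e' \<in> E' - \<phi> ` E \<Longrightarrow> \<gamma>' e' = 0"
  shows "dom.forcing_prob \<gamma> \<le> cod.forcing_prob \<gamma>'"
proof -
  let ?k = "real (card (spins q (E' - \<phi> ` E)))"
  have "cod.mass (\<lambda>\<omega>. \<omega> \<subseteq> \<psi> ` C \<and> cod.forces \<omega> \<gamma>') * cod.mass (\<lambda>_. True)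
      \<le> cod.mass (\<lambda>\<omega>. cod.forces \<omega> \<gamma>') * cod.mass (\<lambda>\<omega>. \<omega> \<subseteq> \<psi> ` C \<and> True)"
    by (rule cod.mass_four_events) (auto intro: cod.forces_mono)
  moreover have "cod.mass (\<lambda>\<omega>. \<omega> \<subseteq> \<psi> ` C \<and> cod.forces \<omega> \<gamma>') = dom.mass (\<lambda>\<omega>. dom.forces \<omega> \<gamma>) * ?k"
    by (rule mass_image) (rule forces_image_iff[OF _ assms])
  moreover have "cod.mass (\<lambda>\<omega>. \<omega> \<subseteq> \<psi> ` C \<and> True) = dom.mass (\<lambda>_. True) * ?k"
    by (rule mass_image) simp
  ultimately have "dom.mass (\<lambda>\<omega>. dom.forces \<omega> \<gamma>) * ?k * cod.mass (\<lambda>_. True)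
      \<le> cod.mass (\<lambda>\<omega>. cod.forces \<omega> \<gamma>') * (dom.mass (\<lambda>_. True) * ?k)" by simp
  moreover have "?k > 0"
  proof -
    have "reduce_mod q (E' - \<phi> ` E) (\<lambda>_. 0) \<in> spins q (E' - \<phi> ` E)"
      by (simp add: reduce_mod_spins dom.q_pos)
    then show ?thesis using finite_spins[of "E' - \<phi> ` E" q] cod.finite_E
      by (auto simp: card_gt_0_iff)
  qed
  ultimately have "dom.mass (\<lambda>\<omega>. dom.forces \<omega> \<gamma>) * cod.mass (\<lambda>_. True)
      \<le> cod.mass (\<lambda>\<omega>. cod.forces \<omega> \<gamma>') * dom.mass (\<lambda>_. True)"
    by (simp add: mult_ac)
  then show ?thesis
    using dom.mass_True_pos cod.mass_True_pos
    by (simp add: dom.forcing_prob_def cod.forcing_prob_def field_simps)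
qed

end

section \<open>The cubical coboundary\<close>

definition dir_sign :: "nat set \<Rightarrow> nat \<Rightarrow> int" where
  "dir_sign S k = (-1) ^ card {l \<in> S. l < k}"

definition cob :: "(cell \<Rightarrow> int) \<Rightarrow> cell \<Rightarrow> int" where
  "cob h = (\<lambda>(v, S). \<Sum>k\<in>S. dir_sign S k * (h (v(k := v k + 1), S - {k}) - h (v, S - {k})))"

definition faces :: "cell \<Rightarrow> cell set" where
  "faces = (\<lambda>(v, S). \<Union>k\<in>S. {(v, S - {k}), (v(k := v k + 1), S - {k})})"

definition inc :: "cell \<Rightarrow> cell \<Rightarrow> int" where
  "inc \<sigma> e = Poly_Mapping.lookup (bdry_cell \<sigma>) e"

lemma dir_sign_cases: "dir_sign S k = 1 \<or> dir_sign S k = -1"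
  unfolding dir_sign_def by (cases "even (card {l \<in> S. l < k})") auto

lemma inc_eq_sum:
  "inc (v, S) e = (\<Sum>k\<in>S. dir_sign S k *
     (of_bool ((v(k := v k + 1), S - {k}) = e) - of_bool ((v, S - {k}) = e)))"
  by (simp add: inc_def bdry_cell_def lookup_sum lookup_minus dir_sign_def of_bool_def when_def eq_commute)

lemma inc_eq_cob: "inc \<sigma> e = cob (\<lambda>y. of_bool (y = e)) \<sigma>"
  by (cases \<sigma>) (simp add: inc_eq_sum cob_def)

lemma inc_face: "inc \<sigma> e \<noteq> 0 \<Longrightarrow> e \<in> faces \<sigma>"
proof (rule ccontr)
  assume "inc \<sigma> e \<noteq> 0" "e \<notin> faces \<sigma>"
  then show False
    by (cases \<sigma>) (auto simp: inc_eq_sum faces_def elim!: sum.not_neutral_contains_not_neutral)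
qed

lemma sum_inc:
  assumes "finite E" and "faces \<sigma> \<subseteq> E"
  shows "(\<Sum>e\<in>E. inc \<sigma> e * h e) = cob h \<sigma>"
proof -
  obtain v S where \<sigma>: "\<sigma> = (v, S)" by force
  have pick: "(\<Sum>e\<in>E. of_bool (y = e) * h e) = h y" if "y \<in> E" for y
    using assms(1) that by (simp add: of_bool_def if_distrib[where f = "\<lambda>b. b * _"] cong: if_cong)
  have "(\<Sum>e\<in>E. inc \<sigma> e * h e) = (\<Sum>e\<in>E. \<Sum>k\<in>S. dir_sign S k *
      (of_bool ((v(k := v k + 1), S - {k}) = e) * h e - of_bool ((v, S - {k}) = e) * h e))"
    by (simp only: \<sigma> inc_eq_sum sum_distrib_right left_diff_distrib mult.assoc)
  also have "\<dots> = (\<Sum>k\<in>S. dir_sign S k * ((\<Sum>e\<in>E. of_bool ((v(k := v k + 1), S - {k}) = e) * h e)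
      - (\<Sum>e\<in>E. of_bool ((v, S - {k}) = e) * h e)))"
    by (subst sum.swap) (simp only: sum_distrib_left[symmetric] sum_subtractf)
  also have "\<dots> = cob h \<sigma>"
    unfolding \<sigma> cob_def prod.case
  proof (intro sum.cong refl)
    fix k assume "k \<in> S"
    then have "(v, S - {k}) \<in> E" "(v(k := v k + 1), S - {k}) \<in> E"
      using assms(2) by (auto simp: \<sigma> faces_def)
    then show "dir_sign S k * ((\<Sum>e\<in>E. of_bool ((v(k := v k + 1), S - {k}) = e) * h e)
        - (\<Sum>e\<in>E. of_bool ((v, S - {k}) = e) * h e))
      = dir_sign S k * (h (v(k := v k + 1), S - {k}) - h (v, S - {k}))"
      by (simp only: pick)
  qed
  finally show ?thesis .
qed

lemma dir_sign_remove_swap: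
  assumes "finite S" and "k \<in> S" and "l \<in> S" and "k \<noteq> l"
  shows "dir_sign S k * dir_sign (S - {k}) l = - (dir_sign S l * dir_sign (S - {l}) k)"
proof -
  have less: "dir_sign S k * dir_sign (S - {k}) l = - (dir_sign S l * dir_sign (S - {l}) k)"
    if "k \<in> S" "k < l" for k l
  proof -
    have "{j \<in> S. j < l} = insert k {j \<in> S - {k}. j < l}" using that by auto
    then have "card {j \<in> S. j < l} = Suc (card {j \<in> S - {k}. j < l})"
      using assms(1) by simp
    moreover have "{j \<in> S - {l}. j < k} = {j \<in> S. j < k}" using that by auto
    ultimately show ?thesis by (simp add: dir_sign_def)
  qed
  show ?thesis using less[of k l] less[of l k] assms(2-4) by (cases "k < l") auto
qed

text \<open>
  This is how the terms of \<open>\<delta>\<delta>\<close> cancel: removing two directions in either order gives the same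
  cell with opposite signs.
\<close>

lemma sum_antisymmetric_off_diagonal:
  fixes B :: "'a \<Rightarrow> 'a \<Rightarrow> int"
  assumes "finite S" and "\<And>k l. k \<in> S \<Longrightarrow> l \<in> S \<Longrightarrow> k \<noteq> l \<Longrightarrow> B k l = - B l k"
  shows "(\<Sum>k\<in>S. \<Sum>l\<in>S - {k}. B k l) = 0"
proof -
  define B' where "B' k l = (if k = l then 0 else B k l)" for k l
  have eq: "(\<Sum>k\<in>S. \<Sum>l\<in>S - {k}. B k l) = (\<Sum>k\<in>S. \<Sum>l\<in>S. B' k l)"
  proof (rule sum.cong[OF refl])
    show "(\<Sum>l\<in>S - {k}. B k l) = (\<Sum>l\<in>S. B' k l)" for k
      using assms(1) by (intro sum.mono_neutral_cong_left) (auto simp: B'_def)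
  qed
  have "(\<Sum>k\<in>S. \<Sum>l\<in>S. B' k l) = (\<Sum>k\<in>S. \<Sum>l\<in>S. - B' l k)"
  proof (intro sum.cong refl)
    fix k l assume "k \<in> S" "l \<in> S"
    then show "B' k l = - B' l k"
      using assms(2)[of k l] by (cases "k = l") (simp_all add: B'_def)
  qed
  also have "\<dots> = - (\<Sum>k\<in>S. \<Sum>l\<in>S. B' k l)"
    by (subst sum.swap) (simp add: sum_negf)
  finally show ?thesis using eq by simp
qed

lemma cob_cob:
  assumes "finite (snd \<sigma>)"
  shows "cob (cob h) \<sigma> = 0"
proof -
  obtain v S where \<sigma>: "\<sigma> = (v, S)" by force
  define B where "B k l = dir_sign S k * dir_sign (S - {k}) l *
    (h (v(k := v k + 1, l := v l + 1), S - {k} - {l}) - h (v(k := v k + 1), S - {k} - {l})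
     - h (v(l := v l + 1), S - {k} - {l}) + h (v, S - {k} - {l}))" for k l
  have "cob (cob h) \<sigma> = (\<Sum>k\<in>S. \<Sum>l\<in>S - {k}. B k l)"
    unfolding \<sigma> cob_def prod.case
  proof (intro sum.cong refl)
    fix k
    let ?a = "\<lambda>l. dir_sign (S - {k}) l * (h ((v(k := v k + 1))(l := (v(k := v k + 1)) l + 1), S - {k} - {l})
      - h (v(k := v k + 1), S - {k} - {l}))"
    let ?b = "\<lambda>l. dir_sign (S - {k}) l * (h (v(l := v l + 1), S - {k} - {l}) - h (v, S - {k} - {l}))"
    have "dir_sign S k * ((\<Sum>l\<in>S - {k}. ?a l) - (\<Sum>l\<in>S - {k}. ?b l))
        = (\<Sum>l\<in>S - {k}. dir_sign S k * (?a l - ?b l))"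
      by (simp only: sum_distrib_left sum_subtractf[symmetric])
    also have "\<dots> = (\<Sum>l\<in>S - {k}. B k l)"
      by (intro sum.cong refl) (auto simp: B_def algebra_simps)
    finally show "dir_sign S k * ((\<Sum>l\<in>S - {k}. ?a l) - (\<Sum>l\<in>S - {k}. ?b l)) = (\<Sum>l\<in>S - {k}. B k l)" .
  qed
  also have "\<dots> = 0"
  proof (rule sum_antisymmetric_off_diagonal)
    fix k l assume kl: "k \<in> S" "l \<in> S" "k \<noteq> l"
    have "S - {k} - {l} = S - {l} - {k}" by blast
    moreover have "v(k := v k + 1, l := v l + 1) = v(l := v l + 1, k := v k + 1)"
      using kl(3) by (rule fun_upd_twist)
    ultimately show "B k l = - B l k"
      unfolding B_def using dir_sign_remove_swap[OF _ kl] assms by (simp add: \<sigma> algebra_simps)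
  qed (use assms in \<open>simp add: \<sigma>\<close>)
  finally show ?thesis .
qed

lemma cob_diff: "cob (\<lambda>e. f e - g e) \<sigma> = cob f \<sigma> - cob g \<sigma>"
  by (cases \<sigma>) (simp add: cob_def sum_subtractf[symmetric] algebra_simps)

lemma cob_scale: "cob (\<lambda>e. t * f e) \<sigma> = t * cob f \<sigma>"
  by (cases \<sigma>) (simp add: cob_def sum_distrib_left algebra_simps)

lemma cob_inc: "finite (snd \<sigma>) \<Longrightarrow> cob (\<lambda>e. inc e x) \<sigma> = 0"
  using cob_cob[of \<sigma> "\<lambda>y. of_bool (y = x)"] by (simp add: inc_eq_cob[abs_def])

text \<open>
  Since all incidence numbers between a cell and its faces are \<open>\<plusminus>1\<close>, a cocycle condition
  determines the value on one face from the values on the others.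
\<close>

lemma cob_dvd_last_face:
  assumes "finite T" and "m \<in> T" and "f0 = (w, T - {m}) \<or> f0 = (w(m := w m + 1), T - {m})"
    and "int q dvd cob h (w, T)" and "\<And>e. e \<in> faces (w, T) \<Longrightarrow> e \<noteq> f0 \<Longrightarrow> int q dvd h e"
  shows "int q dvd h f0"
proof -
  let ?t = "\<lambda>k. dir_sign T k * (h (w(k := w k + 1), T - {k}) - h (w, T - {k}))"
  have ne: "w(k := w k + 1) \<noteq> w" for k by (auto simp: fun_eq_iff)
  have "int q dvd (\<Sum>k\<in>T - {m}. ?t k)"
  proof (intro dvd_sum dvd_mult dvd_diff)
    fix k assume k: "k \<in> T - {m}"
    then have "T - {k} \<noteq> T - {m}" using assms(2) by auto
    then show "int q dvd h (w(k := w k + 1), T - {k})" "int q dvd h (w, T - {k})"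
      using k assms(3) by (auto intro!: assms(5) simp: faces_def)
  qed
  moreover have "cob h (w, T) = ?t m + (\<Sum>k\<in>T - {m}. ?t k)"
    using assms(1,2) by (simp add: cob_def sum.remove)
  ultimately have "int q dvd ?t m" using assms(4) by (simp add: dvd_add_left_iff)
  then have diff: "int q dvd h (w(m := w m + 1), T - {m}) - h (w, T - {m})"
    using dir_sign_cases[of T m] by (auto simp: dvd_diff_commute)
  show ?thesis
    using assms(3)
  proof
    assume f0: "f0 = (w, T - {m})"
    have "int q dvd h (w(m := w m + 1), T - {m})"
      using assms(2) ne by (intro assms(5)) (auto simp: faces_def f0)
    from dvd_diff[OF this diff] show ?thesis by (simp add: f0)
  next
    assume f0: "f0 = (w(m := w m + 1), T - {m})"
    have "int q dvd h (w, T - {m})"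
      using assms(2) ne[of m] by (intro assms(5)) (auto simp: faces_def f0)
    from dvd_add[OF this diff] show ?thesis by (simp add: f0)
  qed
qed

section \<open>The star of a codimension-one face\<close>

text \<open>
  The cells of one dimension more that contain \<open>x\<close>: one extra direction \<open>k\<close>, extending from \<open>x\<close>
  upwards, or downwards if the flag is set.
\<close>

definition coface :: "cell \<Rightarrow> nat \<Rightarrow> bool \<Rightarrow> cell" where
  "coface x k a = ((fst x)(k := fst x k - of_bool a), insert k (snd x))"

lemma inc_coface:
  assumes "finite S" and "k \<notin> S"
  shows "inc (coface (v, S) k a) (v, S) = 1 \<or> inc (coface (v, S) k a) (v, S) = -1"
proof -
  let ?u = "v(k := v k - of_bool a)"
  let ?T = "insert k S"
  have ne: "v(k := v k + 1) \<noteq> v" "v(k := v k - 1) \<noteq> v"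
    by (auto simp: fun_eq_iff)
  have "inc (coface (v, S) k a) (v, S) = (\<Sum>m\<in>{k}. dir_sign ?T m *
      (of_bool ((?u(m := ?u m + 1), ?T - {m}) = (v, S)) - of_bool ((?u, ?T - {m}) = (v, S))))"
    unfolding coface_def fst_conv snd_conv inc_eq_sum
    using assms by (intro sum.mono_neutral_right) auto
  also have "\<dots> = dir_sign ?T k * (if a then 1 else -1)"
    using assms ne by auto
  finally show ?thesis using dir_sign_cases[of ?T k] by (cases a) auto
qed

lemma inc_nonzeroE:
  assumes "inc e x \<noteq> 0"
  obtains k a where "k \<notin> snd x" and "k \<in> snd e" and "e = coface x k a"
proof -
  obtain w T where e: "e = (w, T)" by force
  from inc_face[OF assms] obtain k where k: "k \<in> T" "x = (w, T - {k}) \<or> x = (w(k := w k + 1), T - {k})"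
    by (auto simp: e faces_def)
  from k(2) show ?thesis
  proof
    assume "x = (w, T - {k})"
    then show ?thesis using k by (intro that[of k False]) (auto simp: e coface_def)
  next
    assume "x = (w(k := w k + 1), T - {k})"
    then show ?thesis using k by (intro that[of k True]) (auto simp: e coface_def)
  qed
qed

text \<open>
  Two cofaces of \<open>x\<close> in different directions \<open>k\<close> and \<open>l\<close> span a cell of two dimensions more, and are its only
  faces that contain \<open>x\<close>. If \<open>h\<close> vanishes modulo \<open>q\<close> on the faces that do not contain \<open>x\<close>,
  then vanishing passes from the one coface to the other.
\<close>

lemma dvd_coface_step:
  assumes "finite (snd x)" and k: "k \<notin> snd x" and l: "l \<notin> snd x" and kl: "k \<noteq> l"
    and "int q dvd cob h (coface (coface x k a) l b)"
    and rest: "\<And>e. e \<in> faces (coface (coface x k a) l b) \<Longrightarrow> inc e x = 0 \<Longrightarrow> int q dvd h e"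
    and start: "int q dvd h (coface x k a)"
  shows "int q dvd h (coface x l b)"
proof -
  obtain v S where x: "x = (v, S)" by force
  define w where "w = v(k := v k - of_bool a, l := v l - of_bool b)"
  define T where "T = insert l (insert k S)"
  have \<sigma>: "coface (coface x k a) l b = (w, T)"
    using kl by (simp add: coface_def x w_def T_def)
  have face: "e = (w, T - {k}) \<or> e = (w(k := w k + 1), T - {k})" if "e = coface x l b" for e
  proof -
    have "T - {k} = insert l S" using k kl by (auto simp: T_def x)
    moreover have "w(k := w k + of_bool a) = v(l := v l - of_bool b)"
      using kl by (auto simp: w_def)
    ultimately show ?thesis using that kl by (cases a) (auto simp: coface_def x w_def fun_eq_iff)
  qed
  show ?thesis
  proof (rule cob_dvd_last_face[where w = w and T = T and m = k])
    show "finite T" "k \<in> T" using assms(1) by (simp_all add: T_def x)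
    show "int q dvd cob h (w, T)" using assms(5) by (simp only: \<sigma>)
    show "coface x l b = (w, T - {k}) \<or> coface x l b = (w(k := w k + 1), T - {k})"
      by (rule face) (rule refl)
    fix e assume e: "e \<in> faces (w, T)" "e \<noteq> coface x l b"
    show "int q dvd h e"
    proof (cases "inc e x = 0")
      case True
      then show ?thesis using e(1) by (intro rest) (simp only: \<sigma>)
    next
      case False
      then obtain m c where m: "m \<notin> S" "e = coface x m c" by (auto simp: x elim!: inc_nonzeroE)
      from e(1) obtain j where j: "j \<in> T" "e = (w, T - {j}) \<or> e = (w(j := w j + 1), T - {j})"
        by (auto simp: faces_def)
      have "insert m S = T - {j}" using j m by (auto simp: coface_def x)
      moreover have "k \<notin> S" "l \<notin> S" using k l by (simp_all add: x)
      ultimately have "(m = l \<and> j = k) \<or> (m = k \<and> j = l)"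
        using kl j(1) m(1) unfolding T_def by blast
      then show ?thesis
      proof
        assume mj: "m = l \<and> j = k"
        then have "fst e l = w l" using j(2) kl by auto
        then have "v l - of_bool c = v l - of_bool b" using mj m(2) by (simp add: coface_def x w_def)
        then have "c = b" by (simp add: of_bool_eq_iff)
        then show ?thesis using mj e(2) m(2) by simp
      next
        assume mj: "m = k \<and> j = l"
        then have "fst e k = w k" using j(2) kl by auto
        then have "v k - of_bool c = v k - of_bool a" using mj m(2) kl by (simp add: coface_def x w_def)
        then have "c = a" by (simp add: of_bool_eq_iff)
        then show ?thesis using start mj m(2) by simp
      qed
    qed
  qed
qed

text \<open>
  The cofaces of \<open>x\<close> with adjacency as in the previous lemma form the graph of a
  cross-polytope, which is connected as soon as there are two directions transverse to \<open>x\<close>.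
\<close>

lemma dvd_all_cofaces:
  assumes "finite (snd x)" and "k0 \<in> K - snd x" and "l0 \<in> K - snd x" and "k0 \<noteq> l0"
    and cob: "\<And>k l a b. k \<in> K - snd x \<Longrightarrow> l \<in> K - snd x \<Longrightarrow> k \<noteq> l \<Longrightarrow>
      int q dvd cob h (coface (coface x k a) l b)"
    and rest: "\<And>k l a b e. k \<in> K - snd x \<Longrightarrow> l \<in> K - snd x \<Longrightarrow> k \<noteq> l \<Longrightarrow>
      e \<in> faces (coface (coface x k a) l b) \<Longrightarrow> inc e x = 0 \<Longrightarrow> int q dvd h e"
    and start: "int q dvd h (coface x k0 a0)" and k: "k \<in> K - snd x"
  shows "int q dvd h (coface x k a)"
proof -
  have step: "int q dvd h (coface x l b)"
    if "k \<in> K - snd x" "l \<in> K - snd x" "k \<noteq> l" "int q dvd h (coface x k a)" for k l a b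
  proof (rule dvd_coface_step[OF assms(1) _ _ that(3) cob[OF that(1-3)] _ that(4)])
    show "k \<notin> snd x" "l \<notin> snd x" using that by auto
  qed (rule rest[OF that(1-3)])
  show ?thesis
  proof (cases "k = k0")
    case True
    \<comment> \<open>The two opposite cofaces share no coface, so the path takes a detour through a third one.\<close>
    have "int q dvd h (coface x l0 a)" using step[OF assms(2,3,4) start] .
    then show ?thesis using step[OF assms(3,2)] assms(4) True by simp
  next
    case False
    then show ?thesis using step[OF assms(2) k _ start] by simp
  qed
qed

section \<open>The Higgs model as a constraint system\<close>

lemma finite_bounded_vectors: "finite {u :: nat \<Rightarrow> int. (\<forall>k. \<bar>u k\<bar> \<le> B) \<and> (\<forall>k\<ge>d. u k = 0)}"
proof -
  let ?pad = "\<lambda>f k. if k < d then f k else (0 :: int)"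
  have "u \<in> ?pad ` ({..<d} \<rightarrow>\<^sub>E {-B..B})" if "\<forall>k. \<bar>u k\<bar> \<le> B" "\<forall>k\<ge>d. u k = 0" for u
  proof -
    have "u = ?pad (restrict u {..<d})" using that(2) by (auto simp: fun_eq_iff)
    moreover have "restrict u {..<d} \<in> {..<d} \<rightarrow>\<^sub>E {-B..B}"
      using that(1) by (auto simp: abs_le_iff minus_le_iff)
    ultimately show ?thesis by blast
  qed
  then have "{u. (\<forall>k. \<bar>u k\<bar> \<le> B) \<and> (\<forall>k\<ge>d. u k = 0)} \<subseteq> ?pad ` ({..<d} \<rightarrow>\<^sub>E {-B..B})"
    by blast
  then show ?thesis by (rule finite_subset) (simp add: finite_PiE)
qed

lemma finite_box: "finite (box d N)"
proof (rule finite_subset)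
  show "box d N \<subseteq> {u. (\<forall>k. \<bar>u k\<bar> \<le> int N) \<and> (\<forall>k\<ge>d. u k = 0)} \<times> Pow {..<d}"
  proof (rule subrelI)
    fix v S assume x: "(v, S) \<in> box d N"
    have "\<bar>v k\<bar> \<le> int N" for k
      using x by (cases "k < d") (force simp: box_def cubical_lattice_def lower_def upper_def of_bool_def split: if_splits)+
    then show "(v, S) \<in> {u. (\<forall>k. \<bar>u k\<bar> \<le> int N) \<and> (\<forall>k\<ge>d. u k = 0)} \<times> Pow {..<d}"
      using x by (simp add: box_def cubical_lattice_def)
  qed
qed (simp add: finite_bounded_vectors)

lemma finite_cells_box: "finite (cells (box d N) j)"
  using finite_box by (simp add: cells_def)

lemma in_box_iff:
  "(v, S) \<in> box d N \<longleftrightarrow> (\<forall>k\<ge>d. v k = 0) \<and> S \<subseteq> {..<d} \<and>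
     (\<forall>k<d. - int N \<le> v k \<and> v k + of_bool (k \<in> S) \<le> int N)"
  by (auto simp: box_def cubical_lattice_def lower_def upper_def)

lemma finite_dirs: "x \<in> box d N \<Longrightarrow> finite (snd x)"
  by (cases x) (auto simp: in_box_iff intro: finite_subset)

lemma faces_in_box:
  assumes "\<sigma> \<in> cells (box d N) (Suc j)"
  shows "faces \<sigma> \<subseteq> cells (box d N) j"
proof
  fix e assume "e \<in> faces \<sigma>"
  moreover obtain v S where \<sigma>: "\<sigma> = (v, S)" by force
  ultimately obtain k where k: "k \<in> S" "e = (v, S - {k}) \<or> e = (v(k := v k + 1), S - {k})"
    by (auto simp: faces_def)
  have S: "(v, S) \<in> box d N" "card S = Suc j" using assms by (auto simp: cells_def \<sigma>)
  have kd: "k < d" using S k by (auto simp: in_box_iff)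
  have S': "S - {k} \<subseteq> {..<d}" using S by (auto simp: in_box_iff)
  have bnd: "- int N \<le> v l" "v l + of_bool (l \<in> S) \<le> int N" if "l < d" for l
    using S that by (auto simp: in_box_iff)
  have shrink: "v l + of_bool (l \<in> S - {k}) \<le> int N" if "l < d" for l
    using bnd(2)[OF that] by (auto simp: of_bool_def split: if_splits)
  have "v k + 1 \<le> int N" using bnd(2)[OF kd] k(1) by simp
  then have "(v, S - {k}) \<in> box d N" "(v(k := v k + 1), S - {k}) \<in> box d N"
    using S S' kd bnd(1) shrink by (auto simp: in_box_iff intro: order_trans[OF bnd(1)])
  moreover have "card (S - {k}) = j" using S k by (simp add: card_Diff_singleton)
  ultimately show "e \<in> cells (box d N) j" using k(2) by (auto simp: cells_def)
qed

definition higgs_constraints :: "nat \<Rightarrow> nat \<Rightarrow> nat \<Rightarrow> cell set" where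
  "higgs_constraints i d N = cells (box d N) i \<union> cells (box d N) (i + 1)"

text \<open>
  The linear form whose vanishing the Hamiltonian rewards at the cell \<open>c\<close>: the spin itself on an
  \<open>i\<close>-cell, the coboundary on an \<open>(i+1)\<close>-cell.
\<close>

definition higgs_form :: "nat \<Rightarrow> cell \<Rightarrow> cell \<Rightarrow> int" where
  "higgs_form i c e = (if card (snd c) = i then of_bool (e = c) else inc c e)"

definition higgs_odds :: "real \<Rightarrow> real \<Rightarrow> nat \<Rightarrow> cell \<Rightarrow> real" where
  "higgs_odds \<beta>\<^sub>2 \<beta>\<^sub>1 i c = (if card (snd c) = i then exp \<beta>\<^sub>1 - 1 else exp \<beta>\<^sub>2 - 1)"

lemma pairing_higgs_form_cell:
  assumes "c \<in> cells (box d N) i"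
  shows "pairing (cells (box d N) i) (higgs_form i c) f = f c"
proof -
  have "pairing (cells (box d N) i) (higgs_form i c) f = (\<Sum>e\<in>{c}. of_bool (e = c) * f e)"
    unfolding pairing_def using assms finite_cells_box
    by (intro sum.mono_neutral_cong_right) (auto simp: higgs_form_def cells_def)
  then show ?thesis by simp
qed

lemma pairing_higgs_form_coface:
  assumes "c \<in> cells (box d N) (i + 1)"
  shows "pairing (cells (box d N) i) (higgs_form i c) f = cob f c"
proof -
  have "card (snd c) = Suc i" using assms by (simp add: cells_def)
  then have "pairing (cells (box d N) i) (higgs_form i c) f = (\<Sum>e\<in>cells (box d N) i. inc c e * f e)"
    by (simp add: pairing_def higgs_form_def)
  also have "\<dots> = cob f c"
    by (rule sum_inc[OF finite_cells_box faces_in_box]) (use assms in simp)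
  finally show ?thesis .
qed

section \<open>Surgery at a cell of codimension one\<close>

locale higgs_box =
  fixes i d q N :: nat and \<beta>\<^sub>2 \<beta>\<^sub>1 :: real
  assumes q_gt_1: "q > 1" and \<beta>\<^sub>2_pos: "\<beta>\<^sub>2 > 0" and \<beta>\<^sub>1_pos: "\<beta>\<^sub>1 > 0"
begin

abbreviation "E \<equiv> cells (box d N) i"
abbreviation "C \<equiv> higgs_constraints i d N"

lemma odds_pos: "higgs_odds \<beta>\<^sub>2 \<beta>\<^sub>1 i c > 0"
  using \<beta>\<^sub>2_pos \<beta>\<^sub>1_pos by (simp add: higgs_odds_def)

sublocale constraint_system q E C "higgs_form i" "higgs_odds \<beta>\<^sub>2 \<beta>\<^sub>1 i"
  using q_gt_1 odds_pos finite_cells_box by unfold_locales (auto simp: higgs_constraints_def)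

definition star :: "cell \<Rightarrow> cell set" where
  "star x = {e \<in> E. inc e x \<noteq> 0}"

definition nbhd :: "cell \<Rightarrow> cell set" where
  "nbhd x = {c \<in> C. \<forall>k. \<bar>fst c k - fst x k\<bar> \<le> 1}"

definition interior_cell :: "cell \<Rightarrow> bool" where
  "interior_cell x \<longleftrightarrow> (\<forall>k\<ge>d. fst x k = 0) \<and> snd x \<subseteq> {..<d} \<and> card (snd x) + 1 = i \<and>
     (\<forall>k<d. \<bar>fst x k\<bar> + 1 \<le> int N)"

lemma pairing_cob:
  assumes "c \<in> C"
  shows "pairing E (higgs_form i c) f = (if card (snd c) = i then f c else cob f c)"
proof (cases "card (snd c) = i")
  case True
  then have "c \<in> E" using assms by (auto simp: higgs_constraints_def cells_def)
  then show ?thesis using True by (simp add: pairing_higgs_form_cell[OF \<open>c \<in> E\<close>])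
next
  case False
  then have "c \<in> cells (box d N) (i + 1)" using assms by (auto simp: higgs_constraints_def cells_def)
  then show ?thesis using False by (simp only: pairing_higgs_form_coface if_False)
qed

lemma constraint_finite_dirs: "c \<in> C \<Longrightarrow> finite (snd c)"
  using finite_dirs[of c] by (auto simp: higgs_constraints_def cells_def)

lemma cell_in_E: "c \<in> C \<Longrightarrow> card (snd c) = i \<Longrightarrow> c \<in> E"
  by (auto simp: higgs_constraints_def cells_def)

text \<open>
  The coboundary of the indicator of \<open>x\<close> is closed and vanishes off the star, so it satisfies
  every constraint of an \<open>\<omega>\<close> that avoids the star, while \<open>\<gamma>\<close> detects it.
\<close>

lemma forces_meets_star:
  assumes "forces \<omega> \<gamma>" and "\<omega> \<subseteq> C" and "\<not> int q dvd pairing E \<gamma> (\<lambda>e. inc e x)"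
  shows "star x \<inter> \<omega> \<noteq> {}"
proof
  assume empty: "star x \<inter> \<omega> = {}"
  have "int q dvd pairing E (higgs_form i c) (\<lambda>e. inc e x)" if c: "c \<in> \<omega>" for c
  proof -
    have "c \<in> C" using c assms(2) by auto
    moreover have "inc c x = 0" if "card (snd c) = i"
      using empty c cell_in_E[OF \<open>c \<in> C\<close> that] by (auto simp: star_def)
    ultimately show ?thesis
      by (simp add: pairing_cob cob_inc constraint_finite_dirs)
  qed
  with assms(1,3) show False unfolding forces_iff by blast
qed

lemma coface_coface_in_nbhd:
  assumes "interior_cell x" and k: "k \<in> {..<d} - snd x" and l: "l \<in> {..<d} - snd x" and "k \<noteq> l"
  shows "coface (coface x k a) l b \<in> cells (box d N) (i + 1) \<inter> nbhd x"
    and "faces (coface (coface x k a) l b) \<subseteq> E \<inter> nbhd x"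
proof -
  obtain v S where x: "x = (v, S)" by force
  have S: "S \<subseteq> {..<d}" "card S + 1 = i" "\<And>k. k \<ge> d \<Longrightarrow> v k = 0" "\<And>k. k < d \<Longrightarrow> \<bar>v k\<bar> + 1 \<le> int N"
    using assms(1) by (auto simp: interior_cell_def x)
  then have finS: "finite S" using finite_subset by blast
  let ?\<sigma> = "coface (coface x k a) l b"
  define w where "w = v(k := v k - of_bool a, l := v l - of_bool b)"
  define T where "T = insert l (insert k S)"
  have \<sigma>: "?\<sigma> = (w, T)"
    using assms(4) by (simp add: coface_def x w_def T_def)
  have kl: "k \<notin> S" "l \<notin> S" "k < d" "l < d" using k l by (auto simp: x)
  have cardT: "card T = i + 1" using kl assms(4) finS S(2) by (simp add: T_def)
  have w_near: "v j - 1 \<le> w j \<and> w j \<le> v j" for j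
    by (auto simp: w_def of_bool_def)
  have "w j + of_bool (j \<in> T) \<le> int N \<and> - int N \<le> w j" if "j < d" for j
    using w_near[of j] S(4)[OF that] by (cases "j \<in> T") auto
  moreover have "w j = 0" if "j \<ge> d" for j using S(3)[OF that] that kl by (auto simp: w_def)
  moreover have "T \<subseteq> {..<d}" using S(1) kl by (auto simp: T_def)
  ultimately have box: "?\<sigma> \<in> cells (box d N) (i + 1)"
    unfolding \<sigma> by (simp add: cells_def in_box_iff cardT)
  have near: "\<bar>w j - v j\<bar> \<le> 1" "\<bar>w j + 1 - v j\<bar> \<le> 1" for j using w_near[of j] by auto
  show "?\<sigma> \<in> cells (box d N) (i + 1) \<inter> nbhd x"
    using box near(1) unfolding \<sigma> by (simp add: nbhd_def higgs_constraints_def x)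
  have "faces ?\<sigma> \<subseteq> E" using faces_in_box[of ?\<sigma> d N i] box by simp
  moreover have "\<bar>fst e j - v j\<bar> \<le> 1" if "e \<in> faces ?\<sigma>" for e j
    using that near unfolding \<sigma> by (auto simp: faces_def)
  ultimately show "faces ?\<sigma> \<subseteq> E \<inter> nbhd x"
    by (auto simp: nbhd_def higgs_constraints_def x)
qed

lemma coface_in_E:
  assumes "interior_cell x" and k: "k \<in> {..<d} - snd x"
  shows "coface x k a \<in> E"
proof -
  obtain v S where x: "x = (v, S)" by force
  have S: "S \<subseteq> {..<d}" "card S + 1 = i" "\<And>k. k \<ge> d \<Longrightarrow> v k = 0" "\<And>k. k < d \<Longrightarrow> \<bar>v k\<bar> + 1 \<le> int N"
    using assms(1) by (auto simp: interior_cell_def x)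
  then have finS: "finite S" using finite_subset by blast
  let ?w = "v(k := v k - of_bool a)"
  have "- int N \<le> ?w j \<and> ?w j + of_bool (j \<in> insert k S) \<le> int N" if "j < d" for j
    using S(4)[OF that] by (auto simp: of_bool_def)
  then show ?thesis
    using S k finS by (auto simp: coface_def x cells_def in_box_iff)
qed

lemma star_subset_nbhd:
  shows "star x \<subseteq> nbhd x"
proof
  fix e assume "e \<in> star x"
  then have e: "e \<in> E" "inc e x \<noteq> 0" by (auto simp: star_def)
  from e(2) obtain k a where "e = coface x k a" by (auto elim: inc_nonzeroE)
  then show "e \<in> nbhd x" using e(1) by (auto simp: nbhd_def higgs_constraints_def coface_def)
qed

text \<open>
  After the surgery \<open>f\<close> vanishes on the nearby \<open>i\<close>-cells off the star and is closed on all nearby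
  \<open>(i+1)\<close>-cells, so on the star it agrees with a multiple of the coboundary of the indicator of \<open>x\<close>.
  Subtracting that multiple gives a function \<open>h\<close> that vanishes on the star too and hence satisfies
  all constraints of the old \<open>\<omega>\<close>. The subtracted coboundary is invisible to \<open>\<gamma>\<close>.
\<close>

lemma forces_after_surgery:
  assumes x: "interior_cell x" and "d \<ge> i + 1" and "\<omega> \<subseteq> C" and forced: "forces \<omega> \<gamma>"
    and closed: "pairing E \<gamma> (\<lambda>e. inc e x) = 0"
  shows "forces ((\<omega> \<union> nbhd x) - star x) \<gamma>"
  unfolding forces_iff
proof (intro allI impI)
  fix f assume sat: "\<forall>c\<in>\<omega> \<union> nbhd x - star x. int q dvd pairing E (higgs_form i c) f"
  have S: "snd x \<subseteq> {..<d}" "card (snd x) + 1 = i" using x by (auto simp: interior_cell_def)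
  have fin: "finite (snd x)" using S(1) finite_subset by blast
  have "card ({..<d} - snd x) = d - card (snd x)" using S(1) fin by (simp add: card_Diff_subset)
  then have "card ({..<d} - snd x) \<ge> 2" using S assms(2) by simp
  then obtain k0 l0 where kl: "k0 \<in> {..<d} - snd x" "l0 \<in> {..<d} - snd x" "k0 \<noteq> l0"
    by (meson card_2_iff' obtain_subset_with_card_n subsetD)
  \<comment> \<open>The multiplier is read off at one coface; the inverse of the incidence number \<open>\<plusminus>1\<close> is itself.\<close>
  define \<epsilon> where "\<epsilon> = coface x k0 False"
  define t where "t = f \<epsilon> * inc \<epsilon> x"
  define h where "h e = f e - t * inc e x" for e
  have "inc \<epsilon> x = 1 \<or> inc \<epsilon> x = -1"
    using inc_coface[OF fin, of k0 "fst x" False] kl(1) by (simp add: \<epsilon>_def)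
  then have start: "int q dvd h \<epsilon>" by (auto simp: h_def t_def)
  have cob_h: "cob h c = cob f c" if "c \<in> C" for c
    unfolding h_def[abs_def] cob_diff cob_scale using that by (simp add: cob_inc constraint_finite_dirs)
  have h_coface: "int q dvd h (coface x k a)" if k: "k \<in> {..<d} - snd x" for k a
  proof (rule dvd_all_cofaces[where K = "{..<d}" and ?a0.0 = False and x = x and ?k0.0 = k0 and ?l0.0 = l0])
    show "int q dvd h (coface x k0 False)" using start by (simp add: \<epsilon>_def)
    fix k l a b assume kl': "k \<in> {..<d} - snd x" "l \<in> {..<d} - snd x" "k \<noteq> l"
    note near = coface_coface_in_nbhd[OF x kl']
    let ?\<sigma> = "coface (coface x k a) l b"
    have \<sigma>: "?\<sigma> \<in> C" "?\<sigma> \<in> nbhd x" "card (snd ?\<sigma>) = i + 1"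
      using near(1)[of a b] by (auto simp: higgs_constraints_def cells_def)
    then have "?\<sigma> \<notin> star x" by (auto simp: star_def cells_def)
    then have "int q dvd pairing E (higgs_form i ?\<sigma>) f" using sat \<sigma>(2) by blast
    then have "int q dvd cob f ?\<sigma>" using \<sigma>(3) by (simp add: pairing_cob[OF \<sigma>(1)])
    then show "int q dvd cob h ?\<sigma>" using cob_h[OF \<sigma>(1)] by simp
    fix e assume e: "e \<in> faces ?\<sigma>" "inc e x = 0"
    then have e': "e \<in> E" "e \<in> nbhd x" using near(2)[of a b] by auto
    then have "e \<in> C" "card (snd e) = i" by (auto simp: higgs_constraints_def cells_def)
    moreover have "int q dvd pairing E (higgs_form i e) f"
      using sat e e' by (auto simp: star_def)
    ultimately show "int q dvd h e" using e(2) by (simp add: pairing_cob h_def)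
  qed (use fin kl k in auto)
  have "int q dvd pairing E (higgs_form i c) h" if c: "c \<in> \<omega>" for c
  proof (cases "c \<in> star x")
    case True
    then have cE: "c \<in> E" "inc c x \<noteq> 0" by (auto simp: star_def)
    then obtain k a where k: "k \<notin> snd x" "k \<in> snd c" "c = coface x k a" by (auto elim: inc_nonzeroE)
    have "k < d" using k(2) cE(1) by (cases c) (auto simp: cells_def in_box_iff)
    then have "int q dvd h c" using h_coface[of k a] k by simp
    then show ?thesis by (simp only: pairing_higgs_form_cell[OF cE(1)])
  next
    case False
    have cC: "c \<in> C" using c assms(3) by auto
    have f: "int q dvd pairing E (higgs_form i c) f" using sat c False by auto
    have "inc c x = 0" if "card (snd c) = i"
      using False cell_in_E[OF cC that] by (auto simp: star_def)
    then show ?thesis using f cob_h[OF cC] cC by (auto simp: pairing_cob h_def)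
  qed
  then have "int q dvd pairing E \<gamma> h" using forced unfolding forces_iff by blast
  moreover have "pairing E \<gamma> h = pairing E \<gamma> f"
    unfolding h_def[abs_def] pairing_diff pairing_scale by (simp add: closed)
  ultimately show "int q dvd pairing E \<gamma> f" by simp
qed

end

text \<open>
  Lattice vectors joining \<open>x\<close> to the cells of its neighbourhood; only their finite number matters,
  since it bounds the neighbourhood independently of \<open>x\<close> and of the box.
\<close>

definition offsets :: "nat \<Rightarrow> (nat \<Rightarrow> int) set" where
  "offsets d = {u. (\<forall>k. \<bar>u k\<bar> \<le> 1) \<and> (\<forall>k\<ge>d. u k = 0)}"

lemma (in higgs_box) card_nbhd_le:
  assumes "\<And>k. k \<ge> d \<Longrightarrow> fst x k = 0"
  shows "card (nbhd x) \<le> card (offsets d \<times> Pow {..<d})"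
proof (rule card_inj_on_le)
  let ?g = "\<lambda>c. (\<lambda>k. fst c k - fst x k, snd c)"
  show "inj_on ?g (nbhd x)"
    by (rule inj_onI) (auto simp: fun_eq_iff prod_eq_iff)
  have "?g c \<in> offsets d \<times> Pow {..<d}" if "c \<in> nbhd x" for c
    using that assms by (cases c) (auto simp: nbhd_def offsets_def higgs_constraints_def cells_def in_box_iff)
  then show "?g ` nbhd x \<subseteq> offsets d \<times> Pow {..<d}" by blast
  show "finite (offsets d \<times> Pow {..<d})"
    using finite_bounded_vectors[of 1 d] by (simp add: offsets_def)
qed

section \<open>The boundary of the cube and its halves\<close>

definition corners :: "nat \<Rightarrow> nat \<Rightarrow> (nat \<Rightarrow> int) set" where
  "corners i n = {v. (\<forall>k\<le>i. 0 \<le> v k \<and> v k < int n) \<and> (\<forall>k>i. v k = 0)}"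

lemma corners_fun_upd_iff:
  assumes "k \<le> i"
  shows "v(k := x) \<in> corners i n \<longleftrightarrow> 0 \<le> x \<and> x < int n \<and>
    (\<forall>j\<le>i. j \<noteq> k \<longrightarrow> 0 \<le> v j \<and> v j < int n) \<and> (\<forall>j>i. v j = 0)"
  using assms by (auto simp: corners_def)

lemma corners_shift_iff:
  assumes "k \<le> i" and "0 < v k" and "v k < int n"
  shows "v(k := v k - 1) \<in> corners i n \<longleftrightarrow> v \<in> corners i n"
  using assms corners_fun_upd_iff[OF assms(1), of v "v k"] corners_fun_upd_iff[OF assms(1), of v "v k - 1"]
  by auto

lemma finite_corners: "finite (corners i n)"
proof (rule finite_subset)
  show "corners i n \<subseteq> {u. (\<forall>k. \<bar>u k\<bar> \<le> int n) \<and> (\<forall>k\<ge>Suc i. u k = 0)}"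
  proof
    fix u assume u: "u \<in> corners i n"
    have "\<bar>u k\<bar> \<le> int n" for k using u by (cases "k \<le> i") (auto simp: corners_def less_imp_le)
    then show "u \<in> {u. (\<forall>k. \<bar>u k\<bar> \<le> int n) \<and> (\<forall>k\<ge>Suc i. u k = 0)}"
      using u by (auto simp: corners_def)
  qed
qed (rule finite_bounded_vectors)

lemma lookup_q_loop: "Poly_Mapping.lookup (q_loop i n) e = (\<Sum>u\<in>corners i n. inc (u, {..i}) e)"
  using finite_corners[of i n]
  by (simp add: q_loop_def cube_chain_def bdry_def frag_extend_sum o_def lookup_sum inc_def corners_def)

lemma lookup_q_loop_face:
  assumes "k \<le> i"
  shows "Poly_Mapping.lookup (q_loop i n) (w, {..i} - {k}) =
    dir_sign {..i} k * (of_bool (w(k := w k - 1) \<in> corners i n) - of_bool (w \<in> corners i n))"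
proof -
  have "inc (u, {..i}) (w, {..i} - {k}) = dir_sign {..i} k * (of_bool (u = w(k := w k - 1)) - of_bool (u = w))" for u
  proof -
    have "inc (u, {..i}) (w, {..i} - {k}) = (\<Sum>m\<in>{k}. dir_sign {..i} m *
      (of_bool ((u(m := u m + 1), {..i} - {m}) = (w, {..i} - {k})) - of_bool ((u, {..i} - {m}) = (w, {..i} - {k}))))"
      unfolding inc_eq_sum using assms by (intro sum.mono_neutral_right) auto
    also have "u(k := u k + 1) = w \<longleftrightarrow> u = w(k := w k - 1)"
      by (auto simp: fun_eq_iff)
    then have "(\<Sum>m\<in>{k}. dir_sign {..i} m *
      (of_bool ((u(m := u m + 1), {..i} - {m}) = (w, {..i} - {k})) - of_bool ((u, {..i} - {m}) = (w, {..i} - {k}))))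
      = dir_sign {..i} k * (of_bool (u = w(k := w k - 1)) - of_bool (u = w))" by simp
    finally show ?thesis .
  qed
  then show ?thesis
    using finite_corners[of i n]
    by (simp add: lookup_q_loop sum_distrib_left[symmetric] sum_subtractf of_bool_def)
qed

lemma lookup_q_loop_nonface:
  assumes "\<And>k. k \<le> i \<Longrightarrow> snd e \<noteq> {..i} - {k}"
  shows "Poly_Mapping.lookup (q_loop i n) e = 0"
proof -
  have "inc (u, {..i}) e = 0" for u
  proof (rule ccontr)
    assume "inc (u, {..i}) e \<noteq> 0"
    from inc_face[OF this] obtain k where "k \<le> i" "snd e = {..i} - {k}" by (auto simp: faces_def)
    with assms[of k] show False by simp
  qed
  then show ?thesis by (simp add: lookup_q_loop)
qed

lemma lookup_restrict_chain:
  "Poly_Mapping.lookup (restrict_chain P c) e = (if P e then Poly_Mapping.lookup c e else 0)"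
proof -
  have "Poly_Mapping.lookup (restrict_chain P c) e
      = (\<Sum>x\<in>{x \<in> Poly_Mapping.keys c. P x}. if e = x then Poly_Mapping.lookup c x else 0)"
    unfolding restrict_chain_def lookup_sum by (intro sum.cong) auto
  then show ?thesis by (simp add: in_keys_iff)
qed

lemma lookup_q_upper: "Poly_Mapping.lookup (q_upper i (2 * m)) e
    = (if lower e i \<ge> int m then Poly_Mapping.lookup (q_loop i (2 * m)) e else 0)"
  and lookup_q_lower: "Poly_Mapping.lookup (q_lower i (2 * m)) e
    = (if upper e i \<le> int m then Poly_Mapping.lookup (q_loop i (2 * m)) e else 0)"
proof -
  have "real_of_int x \<ge> real (2 * m) / 2 \<longleftrightarrow> x \<ge> int m" "real_of_int x \<le> real (2 * m) / 2 \<longleftrightarrow> x \<le> int m" for x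
    by linarith+
  then show "Poly_Mapping.lookup (q_upper i (2 * m)) e
    = (if lower e i \<ge> int m then Poly_Mapping.lookup (q_loop i (2 * m)) e else 0)"
    "Poly_Mapping.lookup (q_lower i (2 * m)) e
    = (if upper e i \<le> int m then Poly_Mapping.lookup (q_loop i (2 * m)) e else 0)"
    by (simp_all add: q_upper_def q_lower_def lookup_restrict_chain)
qed

text \<open>
  No cell of the sphere is counted twice or lost: a cell whose height range is the single value
  \<open>m\<close> is orthogonal to the direction \<open>i\<close>, and such cells cancel in the interior of the cube.
\<close>

lemma lookup_q_halves:
  "Poly_Mapping.lookup (q_loop i (2 * m)) e =
     Poly_Mapping.lookup (q_upper i (2 * m)) e + Poly_Mapping.lookup (q_lower i (2 * m)) e"
proof (cases "Poly_Mapping.lookup (q_loop i (2 * m)) e = 0")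
  case False
  obtain w T where e: "e = (w, T)" by force
  from False obtain k where k: "k \<le> i" "T = {..i} - {k}"
    using lookup_q_loop_nonface[of i e] by (auto simp: e)
  have ne: "(w(k := w k - 1) \<in> corners i (2 * m)) \<noteq> (w \<in> corners i (2 * m))"
    using False unfolding e k(2) lookup_q_loop_face[OF k(1)] by auto
  have "(lower e i \<ge> int m) \<noteq> (upper e i \<le> int m)"
  proof (cases "i \<in> T")
    case True
    then show ?thesis by (auto simp: lower_def upper_def e)
  next
    case False
    then have "k = i" using k by auto
    have "m > 0" using ne by (cases m) (auto simp: corners_def)
    have "w i \<noteq> int m"
    proof
      assume "w i = int m"
      then have "w(i := w i - 1) \<in> corners i (2 * m) \<longleftrightarrow> w \<in> corners i (2 * m)"
        using \<open>m > 0\<close> by (intro corners_shift_iff) auto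
      with ne \<open>k = i\<close> show False by simp
    qed
    then show ?thesis using False by (auto simp: lower_def upper_def e)
  qed
  then show ?thesis by (auto simp: lookup_q_upper lookup_q_lower)
qed (simp add: lookup_q_upper lookup_q_lower)

lemma cube_in_box:
  assumes "u \<in> corners i n" and "d \<ge> i + 1" and "N \<ge> n"
  shows "(u, {..i}) \<in> cells (box d N) (i + 1)"
proof -
  have "- int N \<le> u k \<and> u k + of_bool (k \<in> {..i}) \<le> int N" for k
    using assms(1,3) by (cases "k \<le> i") (force simp: corners_def)+
  moreover have "{..i} \<subseteq> {..<d}" "u k = 0" if "k \<ge> d" for k
    using assms(1,2) that by (auto simp: corners_def)
  moreover have "{..i} \<subseteq> {..<d}" using assms(2) by auto
  ultimately show ?thesis by (auto simp: cells_def in_box_iff)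
qed

lemma keys_q_loop:
  assumes "d \<ge> i + 1" and "N \<ge> n"
  shows "Poly_Mapping.keys (q_loop i n) \<subseteq> cells (box d N) i"
proof
  fix e assume "e \<in> Poly_Mapping.keys (q_loop i n)"
  then have "(\<Sum>u\<in>corners i n. inc (u, {..i}) e) \<noteq> 0" by (simp add: in_keys_iff lookup_q_loop)
  then obtain u where u: "u \<in> corners i n" "inc (u, {..i}) e \<noteq> 0"
    by (rule sum.not_neutral_contains_not_neutral)
  have "faces (u, {..i}) \<subseteq> cells (box d N) i"
    using cube_in_box[OF u(1) assms] by (intro faces_in_box) simp
  with inc_face[OF u(2)] show "e \<in> cells (box d N) i" by blast
qed

lemma pairing_q_loop:
  assumes "d \<ge> i + 1" and "N \<ge> n"
  shows "pairing (cells (box d N) i) (Poly_Mapping.lookup (q_loop i n)) h = (\<Sum>u\<in>corners i n. cob h (u, {..i}))"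
proof -
  have "pairing (cells (box d N) i) (Poly_Mapping.lookup (q_loop i n)) h
      = (\<Sum>u\<in>corners i n. \<Sum>e\<in>cells (box d N) i. inc (u, {..i}) e * h e)"
    unfolding pairing_def lookup_q_loop sum_distrib_right by (rule sum.swap)
  also have "\<dots> = (\<Sum>u\<in>corners i n. cob h (u, {..i}))"
    using cube_in_box[OF _ assms] by (intro sum.cong refl sum_inc finite_cells_box faces_in_box) simp
  finally show ?thesis .
qed

text \<open>
  A row of parallel \<open>(i-1)\<close>-cells in the common boundary of the two halves. The row runs in the
  direction 1, which is tangent to that boundary and different from 0 and from \<open>i\<close>; this is
  where \<open>i \<ge> 2\<close> enters. Coordinate 0 is fixed at 0 to stay on one side of the cube.
\<close>

definition equator_cell :: "nat \<Rightarrow> nat \<Rightarrow> nat \<Rightarrow> cell" where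
  "equator_cell i m j = ((\<lambda>k. if k = 1 then int j else if k = i then int m else 0), {1..<i})"

text \<open>
  Around an equator cell the sphere consists of the two side cells above and below it. The lower one
  belongs to the other half, cells in the direction 0 lie in the interior of the cube or outside it,
  and directions beyond \<open>i\<close> leave the space of the cube.
\<close>

lemma q_upper_at_equator:
  assumes "i \<ge> 2" and "j < 2 * m" and "k \<notin> {1..<i}"
    and "k \<noteq> i \<or> a"
  shows "Poly_Mapping.lookup (q_upper i (2 * m)) (coface (equator_cell i m j) k a) = 0"
proof -
  let ?v = "fst (equator_cell i m j)"
  let ?e = "coface (equator_cell i m j) k a"
  have v: "?v 1 = int j" "?v i = int m" "\<And>k. k \<noteq> 1 \<Longrightarrow> k \<noteq> i \<Longrightarrow> ?v k = 0"
    using assms(1) by (auto simp: equator_cell_def)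
  have m: "m > 0" using assms(2) by simp
  consider "k > i" | "k = i" "a" | "k = 0" using assms(3,4) by fastforce
  then show ?thesis
  proof cases
    case 1
    have "k \<in> snd ?e" by (simp add: coface_def)
    moreover have "k \<notin> {..i} - {l}" for l using 1 by simp
    ultimately have "Poly_Mapping.lookup (q_loop i (2 * m)) ?e = 0"
      by (intro lookup_q_loop_nonface) metis
    then show ?thesis by (simp add: lookup_q_upper)
  next
    case 2
    then have "lower ?e i < int m" using v by (simp add: coface_def lower_def)
    then show ?thesis by (simp add: lookup_q_upper)
  next
    case 3
    let ?w = "?v(0 := - of_bool a)"
    have T: "insert 0 {1..<i} = {..i} - {i}" using assms(1) by auto
    have e: "?e = (?w, {..i} - {i})"
      using 3 v(3)[of 0] assms(1) T by (simp add: coface_def equator_cell_def)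
    have "?w(i := ?w i - 1) \<in> corners i (2 * m) \<longleftrightarrow> ?w \<in> corners i (2 * m)"
      using v(2) m assms(1) by (intro corners_shift_iff) auto
    then have "Poly_Mapping.lookup (q_loop i (2 * m)) ?e = 0"
      unfolding e by (subst lookup_q_loop_face) auto
    then show ?thesis by (simp add: lookup_q_upper)
  qed
qed

lemma q_upper_above_equator:
  assumes "i \<ge> 2" and "j < 2 * m"
  shows "Poly_Mapping.lookup (q_upper i (2 * m)) (coface (equator_cell i m j) i False) = - dir_sign {..i} 0"
proof -
  let ?v = "fst (equator_cell i m j)"
  let ?e = "coface (equator_cell i m j) i False"
  have v: "?v 1 = int j" "?v i = int m" "\<And>k. k \<noteq> 1 \<Longrightarrow> k \<noteq> i \<Longrightarrow> ?v k = 0"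
    using assms(1) by (auto simp: equator_cell_def)
  have m: "m > 0" using assms(2) by simp
  have "insert i {1..<i} = {..i} - {0}" using assms(1) by auto
  then have e: "?e = (?v, {..i} - {0})" by (simp add: coface_def) (simp add: equator_cell_def)
  have "?v(0 := ?v 0 - 1) \<notin> corners i (2 * m)"
    using v(3)[of 0] assms(1) by (auto simp: corners_def)
  moreover have "?v \<in> corners i (2 * m)"
    using assms m by (auto simp: corners_def equator_cell_def)
  ultimately have "Poly_Mapping.lookup (q_loop i (2 * m)) ?e = - dir_sign {..i} 0"
    unfolding e by (subst lookup_q_loop_face) auto
  then show ?thesis using v(2) by (simp add: lookup_q_upper lower_def e)
qed

section \<open>Surgery along the equator\<close>

context higgs_box
begin

lemma interior_equator_cell:
  assumes "i \<ge> 2" and "d \<ge> i + 1" and "j < 2 * m" and "N > 2 * m"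
  shows "interior_cell (equator_cell i m j)"
  using assms by (auto simp: interior_cell_def equator_cell_def)

lemma pairing_q_upper_equator:
  assumes "i \<ge> 2" and "d \<ge> i + 1" and "j < 2 * m" and "N > 2 * m"
  shows "\<not> int q dvd pairing E (Poly_Mapping.lookup (q_upper i (2 * m))) (\<lambda>e. inc e (equator_cell i m j))"
proof -
  let ?x = "equator_cell i m j"
  let ?e = "coface ?x i False"
  have x: "snd ?x = {1..<i}" by (simp add: equator_cell_def)
  have e: "?e \<in> E"
    by (rule coface_in_E[OF interior_equator_cell[OF assms]]) (use assms(2) x in auto)
  have "pairing E (Poly_Mapping.lookup (q_upper i (2 * m))) (\<lambda>e. inc e ?x)
      = (\<Sum>e\<in>{?e}. Poly_Mapping.lookup (q_upper i (2 * m)) e * inc e ?x)"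
    unfolding pairing_def
  proof (rule sum.mono_neutral_right[OF finite_E])
    show "\<forall>e\<in>E - {?e}. Poly_Mapping.lookup (q_upper i (2 * m)) e * inc e ?x = 0"
    proof
      fix e assume e: "e \<in> E - {?e}"
      show "Poly_Mapping.lookup (q_upper i (2 * m)) e * inc e ?x = 0"
      proof (cases "inc e ?x = 0")
        case False
        then obtain k a where k: "k \<notin> snd ?x" "e = coface ?x k a" by (auto elim: inc_nonzeroE)
        then have "k \<noteq> i \<or> a" using e by (cases a) auto
        then have "Poly_Mapping.lookup (q_upper i (2 * m)) e = 0"
          unfolding k(2) using k(1) by (intro q_upper_at_equator[OF assms(1,3)]) (simp_all only: x not_False_eq_True)
        then show ?thesis by simp
      qed simp
    qed
  qed (use e in simp)
  also have "\<dots> = - dir_sign {..i} 0 * inc ?e ?x"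
    using q_upper_above_equator[OF assms(1,3)] by simp
  also have "\<dots> = 1 \<or> \<dots> = -1"
  proof -
    have "inc ?e ?x = 1 \<or> inc ?e ?x = -1"
      using inc_coface[of "{1..<i}" i "fst ?x" False] by (simp add: equator_cell_def)
    then show ?thesis using dir_sign_cases[of "{..i}" 0] by auto
  qed
  finally show ?thesis using q_gt_1 by auto
qed

text \<open>
  Surgery at the \<open>2 * m\<close> equator cells. Their stars are disjoint because an \<open>i\<close>-cell containing an equator cell
  has the same coordinate in the direction 1.
\<close>

lemma forcing_prob_halves:
  assumes "i \<ge> 2" and "d \<ge> i + 1" and "N > 2 * m" and "K \<ge> 1"
    and "\<And>c. higgs_odds \<beta>\<^sub>2 \<beta>\<^sub>1 i c \<le> K" and "\<And>c. real q / higgs_odds \<beta>\<^sub>2 \<beta>\<^sub>1 i c \<le> K"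
  shows "real (2 * m) * (forcing_prob (Poly_Mapping.lookup (q_upper i (2 * m)))
      * forcing_prob (Poly_Mapping.lookup (q_lower i (2 * m))))
    \<le> (2 * K) ^ card (offsets d \<times> Pow {..<d}) * forcing_prob (Poly_Mapping.lookup (q_loop i (2 * m)))"
proof (rule forcing_prob_mult_le)
  let ?u = "Poly_Mapping.lookup (q_upper i (2 * m))"
  let ?l = "Poly_Mapping.lookup (q_lower i (2 * m))"
  let ?g = "Poly_Mapping.lookup (q_loop i (2 * m))"
  let ?x = "equator_cell i m"
  have g: "?g = (\<lambda>e. ?u e + ?l e)" by (rule ext) (rule lookup_q_halves)
  have "real (card {..<2 * m}) * mass (\<lambda>\<omega>. forces \<omega> ?u \<and> forces \<omega> ?l)
      \<le> (2 * K) ^ card (offsets d \<times> Pow {..<d}) * mass (\<lambda>\<omega>. forces \<omega> ?g)"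
  proof (rule mass_surgery[where star = "\<lambda>j. star (?x j)" and D = "\<lambda>j. nbhd (?x j)"])
    fix j assume j: "j \<in> {..<2 * m}"
    then have int: "interior_cell (?x j)" using assms by (intro interior_equator_cell) auto
    then show "star (?x j) \<subseteq> nbhd (?x j) \<and> nbhd (?x j) \<subseteq> C
        \<and> card (nbhd (?x j)) \<le> card (offsets d \<times> Pow {..<d})"
      using star_subset_nbhd card_nbhd_le[of "?x j"] by (auto simp: nbhd_def interior_cell_def)
    show "star (?x j) \<inter> star (?x j') = {}" if "j \<noteq> j'" for j'
    proof -
      have first: "fst e 1 = int j" if "e \<in> star (?x j)" for e j
      proof -
        from that obtain k a where k: "k \<notin> snd (?x j)" "e = coface (?x j) k a"
          by (auto simp: star_def elim: inc_nonzeroE)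
        then have "k \<noteq> 1" using assms(1) by (auto simp: equator_cell_def)
        then show ?thesis using k(2) by (simp add: coface_def equator_cell_def)
      qed
      show ?thesis
        using first[of _ j] first[of _ j'] that by fastforce
    qed
    fix \<omega> assume \<omega>: "\<omega> \<subseteq> C" "forces \<omega> ?u \<and> forces \<omega> ?l"
    show "star (?x j) \<inter> \<omega> \<noteq> {}"
      using \<omega> pairing_q_upper_equator[of j m] j assms by (intro forces_meets_star[of _ ?u]) auto
    have "forces \<omega> ?g"
      using \<omega>(2) unfolding forces_def g pairing_add_left by auto
    moreover have "pairing E ?g (\<lambda>e. inc e (?x j)) = 0"
      using assms by (subst pairing_q_loop) (auto simp: cob_inc)
    ultimately show "forces (\<omega> \<union> nbhd (?x j) - star (?x j)) ?g"
      using int assms(2) \<omega>(1) by (intro forces_after_surgery)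
  qed (use assms in auto)
  then show "real (2 * m) * mass (\<lambda>\<omega>. forces \<omega> ?u \<and> forces \<omega> ?l)
      \<le> (2 * K) ^ card (offsets d \<times> Pow {..<d}) * mass (\<lambda>\<omega>. forces \<omega> ?g)" by simp
qed

end

section \<open>The reflection that exchanges the halves\<close>

text \<open>
  The map \<open>x\<^sub>i \<mapsto> n - x\<^sub>i\<close>. A cell that extends in the direction \<open>i\<close> has its upper end become the base
  point, and its reference orientation is reversed.
\<close>

definition reflect :: "nat \<Rightarrow> nat \<Rightarrow> cell \<Rightarrow> cell" where
  "reflect i n = (\<lambda>(v, S). (v(i := int n - v i - of_bool (i \<in> S)), S))"

definition reflect_sign :: "nat \<Rightarrow> cell \<Rightarrow> int" where
  "reflect_sign i x = (if i \<in> snd x then -1 else 1)"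

lemma reflect_reflect [simp]: "reflect i n (reflect i n x) = x"
  by (cases x) (auto simp: reflect_def)

lemma snd_reflect [simp]: "snd (reflect i n x) = snd x"
  by (cases x) (simp add: reflect_def)

lemma inj_reflect: "inj_on (reflect i n) A"
  by (rule inj_on_inverseI[where g = "reflect i n"]) simp

text \<open>
  The reflection exchanges the two faces orthogonal to the direction \<open>i\<close>, which accounts for
  the sign.
\<close>

lemma cob_reflect:
  "cob h (reflect i n \<sigma>) = reflect_sign i \<sigma> * cob (\<lambda>e. reflect_sign i e * h (reflect i n e)) \<sigma>"
proof -
  obtain v S where \<sigma>: "\<sigma> = (v, S)" by force
  define w where "w = v(i := int n - v i - of_bool (i \<in> S))"
  show ?thesis
    unfolding \<sigma> reflect_def prod.case cob_def w_def[symmetric] sum_distrib_left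
  proof (rule sum.cong[OF refl], goal_cases)
    case (1 k)
    then have k: "k \<in> S" .
    let ?h = "\<lambda>e. reflect_sign i e * h (case e of (v, S) \<Rightarrow> (v(i := int n - v i - of_bool (i \<in> S)), S))"
    show ?case
    proof (cases "k = i")
      case True
      have "w = v(i := int n - (v i + 1))" "w(i := w i + 1) = v(i := int n - v i)"
        using k True by (auto simp: w_def)
      then show ?thesis using True k by (simp add: reflect_sign_def algebra_simps)
    next
      case False
      then have "w(k := w k + 1) = v(k := v k + 1, i := int n - v i - of_bool (i \<in> S - {k}))"
        "w = v(i := int n - v i - of_bool (i \<in> S - {k}))"
        by (auto simp: w_def fun_upd_twist)
      then show ?thesis using False by (simp add: reflect_sign_def)
    qed
  qed
qed

lemma inc_reflect:
  "inc (reflect i n \<sigma>) (reflect i n e) = reflect_sign i \<sigma> * reflect_sign i e * inc \<sigma> e"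
proof -
  have "reflect i n y = reflect i n e \<longleftrightarrow> y = e" for y
    by (metis reflect_reflect)
  then have "inc (reflect i n \<sigma>) (reflect i n e)
      = reflect_sign i \<sigma> * cob (\<lambda>y. reflect_sign i y * of_bool (y = e)) \<sigma>"
    by (simp add: inc_eq_cob cob_reflect)
  also have "(\<lambda>y. reflect_sign i y * of_bool (y = e)) = (\<lambda>y. reflect_sign i e * of_bool (y = e))"
    by (auto simp: fun_eq_iff)
  finally show ?thesis by (simp add: cob_scale inc_eq_cob)
qed

lemma reflect_cells:
  assumes "x \<in> cells (box d N) j" and "i < d"
  shows "reflect i n x \<in> cells (box d (N + n)) j"
proof -
  obtain v S where x: "x = (v, S)" by force
  have b: "- int N \<le> v k \<and> v k + of_bool (k \<in> S) \<le> int N" if "k < d" for k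
    using assms(1) that by (auto simp: x cells_def in_box_iff)
  have "- int (N + n) \<le> v k \<and> v k + of_bool (k \<in> S) \<le> int (N + n)" if "k < d" for k
    using b[OF that] by auto
  then show ?thesis
    using assms b[OF assms(2)] by (auto simp: x reflect_def cells_def in_box_iff)
qed

lemma reflect_corner:
  "(\<lambda>u. u(i := int n - u i - 1)) ` corners i n = corners i n"
proof -
  let ?r = "\<lambda>u. u(i := int n - u i - 1)"
  have sub: "?r ` corners i n \<subseteq> corners i n" 
  proof (rule image_subsetI)
    fix u assume "u \<in> corners i n"
    then show "?r u \<in> corners i n"
      unfolding corners_fun_upd_iff[OF order_refl] by (auto simp: corners_def)
  qed
  moreover have "u = ?r (?r u)" for u by auto
  then have "corners i n \<subseteq> ?r ` corners i n" using sub by blast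
  ultimately show ?thesis by (intro equalityI)
qed

lemma lookup_q_loop_reflect:
  "Poly_Mapping.lookup (q_loop i n) (reflect i n e) = - reflect_sign i e * Poly_Mapping.lookup (q_loop i n) e"
proof -
  let ?r = "\<lambda>u. u(i := int n - u i - 1)"
  have inj: "inj_on ?r (corners i n)"
    by (rule inj_on_inverseI[where g = ?r]) auto
  have "Poly_Mapping.lookup (q_loop i n) (reflect i n e)
      = (\<Sum>u\<in>?r ` corners i n. inc (u, {..i}) (reflect i n e))"
    by (simp add: lookup_q_loop reflect_corner)
  also have "\<dots> = (\<Sum>u\<in>corners i n. inc (reflect i n (u, {..i})) (reflect i n e))"
    unfolding sum.reindex[OF inj] by (simp add: reflect_def)
  finally show ?thesis
    by (simp add: inc_reflect lookup_q_loop reflect_sign_def sum_negf)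
qed

lemma lower_reflect: "lower (reflect i n e) i = int n - upper e i"
  and upper_reflect: "upper (reflect i n e) i = int n - lower e i"
  by (cases e, auto simp: reflect_def lower_def upper_def)+

lemma lookup_halves_reflect:
  "Poly_Mapping.lookup (q_lower i (2 * m)) (reflect i (2 * m) e) = -1 * reflect_sign i e * Poly_Mapping.lookup (q_upper i (2 * m)) e"
  "Poly_Mapping.lookup (q_upper i (2 * m)) (reflect i (2 * m) e) = -1 * reflect_sign i e * Poly_Mapping.lookup (q_lower i (2 * m)) e"
  by (simp_all add: lookup_q_upper lookup_q_lower lower_reflect upper_reflect lookup_q_loop_reflect)

section \<open>Volume monotonicity and reflection symmetry\<close>

text \<open>
  The Wilson expectation in the box, written as a forcing probability.
\<close>

definition box_prob :: "real \<Rightarrow> real \<Rightarrow> nat \<Rightarrow> nat \<Rightarrow> nat \<Rightarrow> chain \<Rightarrow> nat \<Rightarrow> real" where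
  "box_prob \<beta>\<^sub>2 \<beta>\<^sub>1 q i d \<gamma> N = constraint_system.forcing_prob q (cells (box d N) i)
     (higgs_constraints i d N) (higgs_form i) (higgs_odds \<beta>\<^sub>2 \<beta>\<^sub>1 i) (Poly_Mapping.lookup \<gamma>)"

lemma higgs_form_support:
  assumes "c \<in> higgs_constraints i d N" and "higgs_form i c e \<noteq> 0"
  shows "e \<in> cells (box d N) i"
proof (cases "card (snd c) = i")
  case True
  then show ?thesis using assms by (auto simp: higgs_form_def higgs_constraints_def cells_def)
next
  case False
  then have "c \<in> cells (box d N) (Suc i)" using assms(1) by (auto simp: higgs_constraints_def cells_def)
  moreover have "e \<in> faces c" using assms(2) False by (intro inc_face) (simp add: higgs_form_def)
  ultimately show ?thesis using faces_in_box by blast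
qed

lemma box_mono: "N \<le> M \<Longrightarrow> cells (box d N) j \<subseteq> cells (box d M) j"
  by (force simp: cells_def box_def)

lemma box_prob_mono:
  assumes "q > 1" and "\<beta>\<^sub>2 > 0" and "\<beta>\<^sub>1 > 0" and "N \<le> M"
    and "Poly_Mapping.keys \<gamma> \<subseteq> cells (box d N) i"
  shows "box_prob \<beta>\<^sub>2 \<beta>\<^sub>1 q i d \<gamma> N \<le> box_prob \<beta>\<^sub>2 \<beta>\<^sub>1 q i d \<gamma> M"
proof -
  interpret D: higgs_box i d q N \<beta>\<^sub>2 \<beta>\<^sub>1 using assms(1-3) by unfold_locales
  interpret R: higgs_box i d q M \<beta>\<^sub>2 \<beta>\<^sub>1 using assms(1-3) by unfold_locales
  interpret constraint_embedding q D.E D.C "higgs_form i" "higgs_odds \<beta>\<^sub>2 \<beta>\<^sub>1 i"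
    R.E R.C "higgs_form i" "higgs_odds \<beta>\<^sub>2 \<beta>\<^sub>1 i" "\<lambda>x. x" "\<lambda>x. x" "\<lambda>_. 1" "\<lambda>_. 1"
  proof unfold_locales
    show "(\<lambda>x. x) ` D.E \<subseteq> R.E" "(\<lambda>x. x) ` D.C \<subseteq> R.C"
      using box_mono[OF assms(4)] by (auto simp: higgs_constraints_def)
    show "higgs_form i c e' = 0" if "c \<in> D.C" "e' \<in> R.E - (\<lambda>x. x) ` D.E" for c e'
      using higgs_form_support[of c i d N e'] that by auto
  qed auto
  show ?thesis
    unfolding box_prob_def by (rule forcing_prob_le[where u = 1]) (use assms(5) in \<open>auto simp: in_keys_iff\<close>)
qed

text \<open>
  The reflection embeds a box into the box that is larger by \<open>n\<close>. An inequality between different volumes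
  suffices, because only the infinite-volume limit is compared.
\<close>

lemma box_prob_reflect:
  assumes "q > 1" and "\<beta>\<^sub>2 > 0" and "\<beta>\<^sub>1 > 0" and "i < d"
    and "Poly_Mapping.keys \<gamma> \<subseteq> cells (box d N) i"
    and \<gamma>': "\<And>e. Poly_Mapping.lookup \<gamma>' (reflect i n e) = -1 * reflect_sign i e * Poly_Mapping.lookup \<gamma> e"
  shows "box_prob \<beta>\<^sub>2 \<beta>\<^sub>1 q i d \<gamma> N \<le> box_prob \<beta>\<^sub>2 \<beta>\<^sub>1 q i d \<gamma>' (N + n)"
proof -
  interpret D: higgs_box i d q N \<beta>\<^sub>2 \<beta>\<^sub>1 using assms(1-3) by unfold_locales
  interpret R: higgs_box i d q "N + n" \<beta>\<^sub>2 \<beta>\<^sub>1 using assms(1-3) by unfold_locales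
  have image: "Poly_Mapping.lookup \<gamma> (reflect i n e') = 0 \<and> (\<forall>c\<in>D.C. higgs_form i c (reflect i n e') = 0)"
    if "e' \<notin> reflect i n ` D.E" for e'
  proof -
    have "reflect i n e' \<notin> D.E" using that by (metis image_eqI reflect_reflect)
    then have "Poly_Mapping.lookup \<gamma> (reflect i n e') = 0" using assms(5) by (auto simp: in_keys_iff)
    moreover have "higgs_form i c (reflect i n e') = 0" if "c \<in> D.C" for c
      using \<open>reflect i n e' \<notin> D.E\<close> higgs_form_support[OF that] by blast
    ultimately show ?thesis by blast
  qed
  have form: "higgs_form i (reflect i n c) (reflect i n e) = reflect_sign i c * reflect_sign i e * higgs_form i c e" for c e
  proof -
    have "reflect i n e = reflect i n c \<longleftrightarrow> e = c" by (metis reflect_reflect)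
    then show ?thesis by (auto simp: higgs_form_def inc_reflect reflect_sign_def)
  qed
  interpret constraint_embedding q D.E D.C "higgs_form i" "higgs_odds \<beta>\<^sub>2 \<beta>\<^sub>1 i"
    R.E R.C "higgs_form i" "higgs_odds \<beta>\<^sub>2 \<beta>\<^sub>1 i" "reflect i n" "reflect i n" "reflect_sign i" "reflect_sign i"
  proof unfold_locales
    show "reflect i n ` D.E \<subseteq> R.E" "reflect i n ` D.C \<subseteq> R.C"
      using reflect_cells[OF _ assms(4)] by (auto simp: higgs_constraints_def)
    fix c e' assume "c \<in> D.C" "e' \<in> R.E - reflect i n ` D.E"
    then have "higgs_form i c (reflect i n e') = 0" using image by blast
    then show "higgs_form i (reflect i n c) e' = 0"
      using form[of c "reflect i n e'"] by simp
  qed (auto simp: inj_reflect form reflect_sign_def higgs_odds_def)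
  show ?thesis
    unfolding box_prob_def
  proof (rule forcing_prob_le[where u = "-1"])
    fix e' assume "e' \<in> R.E - reflect i n ` D.E"
    then show "Poly_Mapping.lookup \<gamma>' e' = 0"
      using image[of e'] \<gamma>'[of "reflect i n e'"] by simp
  qed (use \<gamma>' in auto)
qed

text \<open>
  With all constraints open the zero cochain is the only solution, and it is annihilated by
  every chain.
\<close>

lemma (in higgs_box) box_prob_pos: "box_prob \<beta>\<^sub>2 \<beta>\<^sub>1 q i d \<gamma> N > 0"
proof -
  have zero: "f e = 0" if "f \<in> solutions C" "e \<in> E" for f e
  proof -
    have "e \<in> C" using that(2) by (simp add: higgs_constraints_def)
    then have "int q dvd pairing E (higgs_form i e) f" using that(1) by (simp add: solutions_def)
    then have "int q dvd f e" by (simp only: pairing_higgs_form_cell[OF that(2)])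
    moreover have "f e \<in> {0..<int q}" using that by (auto simp: solutions_def spins_def)
    ultimately show ?thesis by (auto dest: zdvd_imp_le)
  qed
  then have "pairing E \<gamma>' f = 0" if "f \<in> solutions C" for f \<gamma>'
    using zero[OF that] unfolding pairing_def by (intro sum.neutral) simp
  then have "forces C (Poly_Mapping.lookup \<gamma>)" by (simp add: forces_def)
  then have "weight C \<le> mass (\<lambda>\<omega>. forces \<omega> (Poly_Mapping.lookup \<gamma>))"
    by (intro mass_ge_weight) auto
  then show ?thesis
    using weight_pos[of C] mass_True_pos by (simp add: box_prob_def forcing_prob_def)
qed

section \<open>Wilson expectations\<close>

definition chain_sum :: "chain \<Rightarrow> (cell \<Rightarrow> int) \<Rightarrow> int" where
  "chain_sum \<gamma> f = (\<Sum>x\<in>Poly_Mapping.keys \<gamma>. Poly_Mapping.lookup \<gamma> x * f x)"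

lemma wilson_eq_cis:
  assumes "q > 0"
  shows "wilson q \<gamma> f = cis (2 * pi * of_int (chain_sum \<gamma> f) / of_nat q)"
proof -
  let ?x = "chain_sum \<gamma> f"
  have "real_of_int ?x = of_int (?x mod int q + int q * (?x div int q))" by simp
  then have split: "real_of_int ?x = of_int (?x mod int q) + real q * of_int (?x div int q)"
    by (simp only: of_int_add of_int_mult of_int_of_nat_eq)
  have "2 * pi * of_int ?x / of_nat q = 2 * pi * of_int (?x mod int q) / of_nat q + 2 * pi * of_int (?x div int q)"
    unfolding split using assms by (simp add: field_simps)
  then have "cis (2 * pi * of_int ?x / of_nat q) = cis (2 * pi * of_int (?x mod int q) / of_nat q)"
    by (simp only: cis_mult[symmetric] cis_multiple_2pi Ints_of_int mult_1_right)
  then show ?thesis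
    by (simp add: wilson_def eval_chain_def chain_sum_def cis_conv_exp mult_ac)
qed

lemma chain_sum_eq_pairing:
  assumes "finite E" and "Poly_Mapping.keys \<gamma> \<subseteq> E"
  shows "chain_sum \<gamma> f = pairing E (Poly_Mapping.lookup \<gamma>) f"
  unfolding chain_sum_def pairing_def using assms
  by (intro sum.mono_neutral_left) (auto simp: in_keys_iff)

lemma measurable_wilson:
  assumes "q > 0" and "Poly_Mapping.keys \<gamma> \<subseteq> cells (cubical_lattice d) i"
  shows "wilson q \<gamma> \<in> borel_measurable (cochain_space q i d)"
proof -
  have "(\<lambda>f. real_of_int (f x)) \<in> borel_measurable (cochain_space q i d)" if "x \<in> Poly_Mapping.keys \<gamma>" for x
  proof -
    have "x \<in> cells (cubical_lattice d) i" using assms(2) that by auto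
    then have "(\<lambda>f. f x) \<in> measurable (cochain_space q i d) (count_space {0..<int q})"
      unfolding cochain_space_def by (rule measurable_component_singleton)
    then show ?thesis by (rule measurable_compose) simp
  qed
  then have "(\<lambda>f. \<Sum>x\<in>Poly_Mapping.keys \<gamma>. of_int (Poly_Mapping.lookup \<gamma> x) * real_of_int (f x))
      \<in> borel_measurable (cochain_space q i d)"
    by (intro borel_measurable_sum borel_measurable_times) auto
  then have "(\<lambda>f. real_of_int (chain_sum \<gamma> f)) \<in> borel_measurable (cochain_space q i d)"
    by (simp add: chain_sum_def)
  then have "(\<lambda>f. cis (2 * pi * real_of_int (chain_sum \<gamma> f) / of_nat q)) \<in> borel_measurable (cochain_space q i d)"
    unfolding cis_conv_exp by measurable
  then show ?thesis by (simp add: wilson_eq_cis[OF assms(1), abs_def])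
qed

lemma continuous_map_wilson:
  assumes "q > 0" and "Poly_Mapping.keys \<gamma> \<subseteq> cells (cubical_lattice d) i"
  shows "continuous_map (cochain_topology q i d) euclidean (wilson q \<gamma>)"
proof -
  let ?T = "cochain_topology q i d"
  have "continuous_map ?T euclideanreal (\<lambda>f. real_of_int (f x))" if "x \<in> Poly_Mapping.keys \<gamma>" for x
  proof -
    have x: "x \<in> cells (cubical_lattice d) i" using assms(2) that by auto
    have "continuous_map ?T (discrete_topology {0..<int q}) (\<lambda>f. f x)"
      using continuous_map_product_projection[OF x, of "\<lambda>_. discrete_topology {0..<int q}"]
      by (simp add: cochain_topology_def)
    from continuous_map_compose[OF this, of euclideanreal real_of_int] show ?thesis
      by (simp add: o_def)
  qed
  then have "continuous_map ?T euclideanreal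
      (\<lambda>f. \<Sum>x\<in>Poly_Mapping.keys \<gamma>. of_int (Poly_Mapping.lookup \<gamma> x) * real_of_int (f x))"
    by (intro continuous_map_sum continuous_map_real_mult) auto
  then have sum: "continuous_map ?T euclideanreal (\<lambda>f. real_of_int (chain_sum \<gamma> f))"
    by (simp add: chain_sum_def)
  have "continuous_map euclideanreal euclidean (\<lambda>x. cis (2 * pi * x / of_nat q))"
    using assms(1) by (auto intro!: continuous_intros)
  from continuous_map_compose[OF sum this] show ?thesis
    by (simp add: o_def wilson_eq_cis[OF assms(1), abs_def])
qed

lemma cells_box_subset_lattice: "cells (box d N) j \<subseteq> cells (cubical_lattice d) j"
  by (auto simp: cells_def box_def)

context higgs_box
begin

lemma cochains_eq_spins: "cochains q i (box d N) = spins q E"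
  by (simp add: cochains_def spins_def)

lemma coboundary_zero_iff:
  assumes "\<sigma> \<in> cells (box d N) (i + 1)"
  shows "coboundary q f \<sigma> = 0 \<longleftrightarrow> int q dvd pairing E (higgs_form i \<sigma>) f"
proof -
  have \<sigma>: "card (snd \<sigma>) = Suc i" "\<sigma> \<in> cells (box d N) (Suc i)" using assms by (auto simp: cells_def)
  have keys: "Poly_Mapping.keys (bdry_cell \<sigma>) \<subseteq> E"
    using faces_in_box[OF \<sigma>(2)] inc_face[of \<sigma>] by (auto simp: in_keys_iff inc_def)
  have "coboundary q f \<sigma> = chain_sum (bdry_cell \<sigma>) f mod int q"
    by (simp add: coboundary_def bdry_def eval_chain_def chain_sum_def)
  also have "chain_sum (bdry_cell \<sigma>) f = pairing E (higgs_form i \<sigma>) f"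
    unfolding chain_sum_eq_pairing[OF finite_E keys] using \<sigma>(1)
    by (simp add: pairing_def higgs_form_def inc_def)
  finally show ?thesis by (simp add: dvd_eq_mod_eq_0)
qed

text \<open>
  Each term of the Hamiltonian is an indicator \<open>I\<close>, and \<open>exp (\<beta> I) = 1 + (exp \<beta> - 1) I\<close>.
\<close>

lemma higgs_weight_eq_spin_weight:
  assumes "f \<in> spins q E"
  shows "higgs_weight \<beta>\<^sub>2 \<beta>\<^sub>1 q i (box d N) f = spin_weight f"
proof -
  let ?I = "\<lambda>c. of_bool (int q dvd pairing E (higgs_form i c) f) :: real"
  have cell: "of_bool (f \<epsilon> = 0) = ?I \<epsilon>" if "\<epsilon> \<in> E" for \<epsilon>
  proof -
    have "f \<epsilon> \<in> {0..<int q}" using assms that by (auto simp: spins_def)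
    then have "f \<epsilon> = 0 \<longleftrightarrow> int q dvd f \<epsilon>" by (auto dest: zdvd_imp_le)
    then show ?thesis by (simp only: pairing_higgs_form_cell[OF that])
  qed
  have split: "exp (\<beta> * (\<Sum>c\<in>S. ?I c)) = (\<Prod>c\<in>S. 1 + (exp \<beta> - 1) * ?I c)" if "finite S" for \<beta> S
    unfolding sum_distrib_left exp_sum[OF that] by (intro prod.cong refl) simp
  have disj: "E \<inter> cells (box d N) (i + 1) = {}" by (auto simp: cells_def)
  have "higgs_weight \<beta>\<^sub>2 \<beta>\<^sub>1 q i (box d N) f
      = exp (\<beta>\<^sub>1 * (\<Sum>c\<in>E. ?I c)) * exp (\<beta>\<^sub>2 * (\<Sum>c\<in>cells (box d N) (i + 1). ?I c))"
    by (simp add: higgs_weight_def coboundary_zero_iff[simplified] cell exp_add[symmetric] add.commute)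
  also have "\<dots> = (\<Prod>c\<in>E. 1 + (exp \<beta>\<^sub>1 - 1) * ?I c) * (\<Prod>c\<in>cells (box d N) (i + 1). 1 + (exp \<beta>\<^sub>2 - 1) * ?I c)"
    by (simp only: split finite_cells_box)
  also have "\<dots> = (\<Prod>c\<in>E. 1 + higgs_odds \<beta>\<^sub>2 \<beta>\<^sub>1 i c * ?I c)
      * (\<Prod>c\<in>cells (box d N) (i + 1). 1 + higgs_odds \<beta>\<^sub>2 \<beta>\<^sub>1 i c * ?I c)"
    by (intro arg_cong2[where f = "(*)"] prod.cong refl) (auto simp: higgs_odds_def cells_def)
  also have "\<dots> = spin_weight f"
    unfolding spin_weight_def unfolding higgs_constraints_def
    by (rule prod.union_disjoint[symmetric, OF finite_cells_box finite_cells_box disj])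
  finally show ?thesis .
qed

lemma integral_box_higgs_measure:
  fixes g :: "(cell \<Rightarrow> int) \<Rightarrow> 'b :: {banach, second_countable_topology}"
  assumes "g \<in> borel_measurable (cochain_space q i d)"
  shows "integral\<^sup>L (box_higgs_measure \<beta>\<^sub>2 \<beta>\<^sub>1 q i d N) g =
    (\<Sum>f\<in>spins q E. (spin_weight f / (\<Sum>g\<in>spins q E. spin_weight g)) *\<^sub>R g (extend_zero i d (box d N) f))"
proof -
  let ?w = "\<lambda>f. higgs_weight \<beta>\<^sub>2 \<beta>\<^sub>1 q i (box d N) f
    / (\<Sum>g\<in>cochains q i (box d N). higgs_weight \<beta>\<^sub>2 \<beta>\<^sub>1 q i (box d N) g)"
  have fin: "finite (cochains q i (box d N))"
    unfolding cochains_eq_spins by (rule finite_spins[OF finite_E])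
  have "extend_zero i d (box d N) f \<in> space (cochain_space q i d)" if "f \<in> cochains q i (box d N)" for f
    using that q_gt_1 by (auto simp: cochain_space_def space_PiM extend_zero_def cochains_def)
  then have "extend_zero i d (box d N) \<in> measurable (higgs_measure \<beta>\<^sub>2 \<beta>\<^sub>1 q i (box d N)) (cochain_space q i d)"
    by (auto simp: higgs_measure_def)
  then have "integral\<^sup>L (box_higgs_measure \<beta>\<^sub>2 \<beta>\<^sub>1 q i d N) g
      = integral\<^sup>L (higgs_measure \<beta>\<^sub>2 \<beta>\<^sub>1 q i (box d N)) (\<lambda>f. g (extend_zero i d (box d N) f))"
    unfolding box_higgs_measure_def using assms by (rule integral_distr)
  also have "\<dots> = (\<Sum>f\<in>cochains q i (box d N). ?w f *\<^sub>R g (extend_zero i d (box d N) f))"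
    unfolding higgs_measure_def
    by (rule lebesgue_integral_point_measure_finite[OF fin])
      (auto simp: higgs_weight_def intro!: divide_nonneg_nonneg sum_nonneg)
  also have "\<dots> = (\<Sum>f\<in>spins q E. (spin_weight f / (\<Sum>g\<in>spins q E. spin_weight g)) *\<^sub>R g (extend_zero i d (box d N) f))"
    unfolding cochains_eq_spins by (simp add: higgs_weight_eq_spin_weight cong: sum.cong)
  finally show ?thesis .
qed

lemma box_expectation_wilson:
  assumes "Poly_Mapping.keys \<gamma> \<subseteq> E"
  shows "integral\<^sup>L (box_higgs_measure \<beta>\<^sub>2 \<beta>\<^sub>1 q i d N) (\<lambda>f. Re (wilson q \<gamma> f)) = box_prob \<beta>\<^sub>2 \<beta>\<^sub>1 q i d \<gamma> N"
    and "integral\<^sup>L (box_higgs_measure \<beta>\<^sub>2 \<beta>\<^sub>1 q i d N) (\<lambda>f. Im (wilson q \<gamma> f)) = 0"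
proof -
  have keys: "Poly_Mapping.keys \<gamma> \<subseteq> cells (cubical_lattice d) i"
    using assms cells_box_subset_lattice by blast
  have meas: "wilson q \<gamma> \<in> borel_measurable (cochain_space q i d)"
    by (rule measurable_wilson[OF q_pos keys])
  have ext: "wilson q \<gamma> (extend_zero i d (box d N) f) = phase (Poly_Mapping.lookup \<gamma>) f" for f
  proof -
    have "chain_sum \<gamma> (extend_zero i d (box d N) f) = chain_sum \<gamma> f"
      unfolding chain_sum_def using assms keys
      by (intro sum.cong refl) (auto simp: extend_zero_def)
    then show ?thesis
      by (simp add: wilson_eq_cis[OF q_pos] chain_sum_eq_pairing[OF finite_E assms] phase_def)
  qed
  define a where "a f = spin_weight f / (\<Sum>g\<in>spins q E. spin_weight g)" for f
  have total: "(\<Sum>f\<in>spins q E. complex_of_real (a f) * phase (Poly_Mapping.lookup \<gamma>) f)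
      = of_real (box_prob \<beta>\<^sub>2 \<beta>\<^sub>1 q i d \<gamma> N)"
    unfolding a_def box_prob_def by (rule expectation_phase)
  have "integral\<^sup>L (box_higgs_measure \<beta>\<^sub>2 \<beta>\<^sub>1 q i d N) (\<lambda>f. Re (wilson q \<gamma> f))
      = Re (\<Sum>f\<in>spins q E. complex_of_real (a f) * phase (Poly_Mapping.lookup \<gamma>) f)"
    using meas by (subst integral_box_higgs_measure) (auto simp: ext a_def)
  then show "integral\<^sup>L (box_higgs_measure \<beta>\<^sub>2 \<beta>\<^sub>1 q i d N) (\<lambda>f. Re (wilson q \<gamma> f)) = box_prob \<beta>\<^sub>2 \<beta>\<^sub>1 q i d \<gamma> N"
    by (simp add: total)
  have "integral\<^sup>L (box_higgs_measure \<beta>\<^sub>2 \<beta>\<^sub>1 q i d N) (\<lambda>f. Im (wilson q \<gamma> f))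
      = Im (\<Sum>f\<in>spins q E. complex_of_real (a f) * phase (Poly_Mapping.lookup \<gamma>) f)"
    using meas by (subst integral_box_higgs_measure) (auto simp: ext a_def)
  then show "integral\<^sup>L (box_higgs_measure \<beta>\<^sub>2 \<beta>\<^sub>1 q i d N) (\<lambda>f. Im (wilson q \<gamma> f)) = 0"
    by (simp add: total)
qed

end

text \<open>
  Weak convergence is stated for real test functions, so it is applied to the real and the imaginary
  part; the imaginary parts vanish in every finite box.
\<close>

lemma wilson_limit:
  assumes "q > 1" and "\<beta>\<^sub>2 > 0" and "\<beta>\<^sub>1 > 0" and \<mu>: "is_infinite_higgs_measure \<beta>\<^sub>2 \<beta>\<^sub>1 q i d \<mu>"
    and keys: "Poly_Mapping.keys \<gamma> \<subseteq> cells (box d N\<^sub>0) i"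
  obtains P where "integral\<^sup>L \<mu> (wilson q \<gamma>) = of_real P" and "box_prob \<beta>\<^sub>2 \<beta>\<^sub>1 q i d \<gamma> \<longlonglongrightarrow> P"
proof -
  have q: "q > 0" using assms(1) by simp
  have keys': "Poly_Mapping.keys \<gamma> \<subseteq> cells (cubical_lattice d) i"
    using keys cells_box_subset_lattice by blast
  interpret prob_space \<mu> using \<mu> by (simp add: is_infinite_higgs_measure_def)
  have "wilson q \<gamma> \<in> borel_measurable \<mu>"
    using measurable_wilson[OF q keys'] \<mu>
    by (simp add: is_infinite_higgs_measure_def cong: measurable_cong_sets)
  moreover have norm: "norm (wilson q \<gamma> f) = 1" for f by (simp add: wilson_eq_cis[OF q])
  ultimately have int: "integrable \<mu> (wilson q \<gamma>)"
    by (intro integrable_const_bound[where B = 1]) auto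
  have conv: "(\<lambda>N. integral\<^sup>L (box_higgs_measure \<beta>\<^sub>2 \<beta>\<^sub>1 q i d N) (\<lambda>f. T (wilson q \<gamma> f)))
      \<longlonglongrightarrow> T (integral\<^sup>L \<mu> (wilson q \<gamma>))"
    if T: "bounded_linear T" and T_le: "\<And>z. \<bar>T z\<bar> \<le> norm z" for T :: "complex \<Rightarrow> real"
  proof -
    have "continuous_on UNIV T" using T by (rule linear_continuous_on)
    then have "continuous_map euclidean euclideanreal T" by simp
    from continuous_map_compose[OF continuous_map_wilson[OF q keys'] this]
    have "continuous_map (cochain_topology q i d) euclideanreal (\<lambda>f. T (wilson q \<gamma> f))"
      by (simp add: o_def)
    moreover have "bounded ((\<lambda>f. T (wilson q \<gamma> f)) ` topspace (cochain_topology q i d))"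
      using T_le norm by (intro boundedI[where B = 1]) (auto, metis)
    ultimately have "(\<lambda>N. integral\<^sup>L (box_higgs_measure \<beta>\<^sub>2 \<beta>\<^sub>1 q i d N) (\<lambda>f. T (wilson q \<gamma> f)))
      \<longlonglongrightarrow> integral\<^sup>L \<mu> (\<lambda>f. T (wilson q \<gamma> f))"
      using \<mu> by (auto simp: is_infinite_higgs_measure_def weak_limit_def)
    also have "integral\<^sup>L \<mu> (\<lambda>f. T (wilson q \<gamma> f)) = T (integral\<^sup>L \<mu> (wilson q \<gamma>))"
      by (rule integral_bounded_linear[OF T int])
    finally show ?thesis .
  qed
  have box: "integral\<^sup>L (box_higgs_measure \<beta>\<^sub>2 \<beta>\<^sub>1 q i d N) (\<lambda>f. Re (wilson q \<gamma> f)) = box_prob \<beta>\<^sub>2 \<beta>\<^sub>1 q i d \<gamma> N"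
    "integral\<^sup>L (box_higgs_measure \<beta>\<^sub>2 \<beta>\<^sub>1 q i d N) (\<lambda>f. Im (wilson q \<gamma> f)) = 0" if "N \<ge> N\<^sub>0" for N
  proof -
    interpret higgs_box i d q N \<beta>\<^sub>2 \<beta>\<^sub>1 using assms(1-3) by unfold_locales
    have "Poly_Mapping.keys \<gamma> \<subseteq> E" using keys box_mono[OF that] by blast
    from box_expectation_wilson[OF this]
    show "integral\<^sup>L (box_higgs_measure \<beta>\<^sub>2 \<beta>\<^sub>1 q i d N) (\<lambda>f. Re (wilson q \<gamma> f)) = box_prob \<beta>\<^sub>2 \<beta>\<^sub>1 q i d \<gamma> N"
      "integral\<^sup>L (box_higgs_measure \<beta>\<^sub>2 \<beta>\<^sub>1 q i d N) (\<lambda>f. Im (wilson q \<gamma> f)) = 0" .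
  qed
  have "box_prob \<beta>\<^sub>2 \<beta>\<^sub>1 q i d \<gamma> \<longlonglongrightarrow> Re (integral\<^sup>L \<mu> (wilson q \<gamma>))"
    using conv[OF bounded_linear_Re abs_Re_le_cmod]
    by (rule Lim_transform_eventually) (auto intro: eventually_sequentiallyI[of N\<^sub>0] simp: box)
  moreover have "(\<lambda>_. 0) \<longlonglongrightarrow> Im (integral\<^sup>L \<mu> (wilson q \<gamma>))"
    using conv[OF bounded_linear_Im abs_Im_le_cmod]
    by (rule Lim_transform_eventually) (auto intro: eventually_sequentiallyI[of N\<^sub>0] simp: box)
  then have "Im (integral\<^sup>L \<mu> (wilson q \<gamma>)) = 0" by (simp add: LIMSEQ_const_iff)
  then have "integral\<^sup>L \<mu> (wilson q \<gamma>) = of_real (Re (integral\<^sup>L \<mu> (wilson q \<gamma>)))"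
    by (simp add: complex_eq_iff)
  ultimately show ?thesis using that by blast
qed

lemma keys_halves:
  "Poly_Mapping.keys (q_upper i (2 * m)) \<subseteq> Poly_Mapping.keys (q_loop i (2 * m))"
  "Poly_Mapping.keys (q_lower i (2 * m)) \<subseteq> Poly_Mapping.keys (q_loop i (2 * m))"
  by (auto simp: in_keys_iff lookup_q_upper lookup_q_lower split: if_splits)

section \<open>The ratio tends to zero\<close>

theorem proposition30:
  fixes i d q :: nat and \<beta>\<^sub>2 \<beta>\<^sub>1 :: real and \<mu> :: "(cell \<Rightarrow> int) measure"
  assumes "i \<ge> 2" and "d \<ge> i + 1" and "prime q" and "\<beta>\<^sub>2 > 0" and "\<beta>\<^sub>1 > 0"
    and "is_infinite_higgs_measure \<beta>\<^sub>2 \<beta>\<^sub>1 q i d \<mu>"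
  shows "(\<forall>n. even n \<longrightarrow>
            integral\<^sup>L \<mu> (wilson q (q_loop i n)) \<noteq> 0 \<and>
            mf_ratio \<mu> q i n =
              (integral\<^sup>L \<mu> (wilson q (q_upper i n)))\<^sup>2 / integral\<^sup>L \<mu> (wilson q (q_loop i n)))
       \<and> (\<lambda>m. mf_ratio \<mu> q i (2 * m)) \<longlonglongrightarrow> 0"
proof -
  have q: "q > 1" using assms(3) by (rule prime_gt_1_nat)
  \<comment> \<open>\<open>K\<close> bounds the effect of opening or closing one cell on the weight.\<close>
  define K where "K = 1 + (exp \<beta>\<^sub>1 - 1) + (exp \<beta>\<^sub>2 - 1) + q / (exp \<beta>\<^sub>1 - 1) + q / (exp \<beta>\<^sub>2 - 1)"
  define M where "M = (2 * K) ^ card (offsets d \<times> Pow {..<d})"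
  have odds: "exp \<beta>\<^sub>1 - 1 > 0" "exp \<beta>\<^sub>2 - 1 > 0" using assms by auto
  then have parts: "q / (exp \<beta>\<^sub>1 - 1) \<ge> 0" "q / (exp \<beta>\<^sub>2 - 1) \<ge> 0" by simp_all
  have K: "K \<ge> 1" "\<And>c. higgs_odds \<beta>\<^sub>2 \<beta>\<^sub>1 i c \<le> K" "\<And>c. q / higgs_odds \<beta>\<^sub>2 \<beta>\<^sub>1 i c \<le> K"
  proof -
    show "K \<ge> 1" unfolding K_def using odds parts by linarith
    fix c
    have "higgs_odds \<beta>\<^sub>2 \<beta>\<^sub>1 i c = exp \<beta>\<^sub>1 - 1 \<or> higgs_odds \<beta>\<^sub>2 \<beta>\<^sub>1 i c = exp \<beta>\<^sub>2 - 1"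
      by (simp add: higgs_odds_def)
    then show "higgs_odds \<beta>\<^sub>2 \<beta>\<^sub>1 i c \<le> K" "q / higgs_odds \<beta>\<^sub>2 \<beta>\<^sub>1 i c \<le> K"
      using odds parts unfolding K_def by (elim disjE; simp only: refl; linarith)+
  qed
  note params = q assms(4,5)
  let ?P = "box_prob \<beta>\<^sub>2 \<beta>\<^sub>1 q i d"
  have main: "integral\<^sup>L \<mu> (wilson q (q_upper i (2 * m))) = integral\<^sup>L \<mu> (wilson q (q_lower i (2 * m))) \<and>
    integral\<^sup>L \<mu> (wilson q (q_loop i (2 * m))) \<noteq> 0 \<and> real (2 * m) * norm (mf_ratio \<mu> q i (2 * m)) \<le> M" for m
  proof -
    let ?u = "q_upper i (2 * m)" and ?l = "q_lower i (2 * m)" and ?g = "q_loop i (2 * m)"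
    have kg: "Poly_Mapping.keys ?g \<subseteq> cells (box d N) i" if "N \<ge> 2 * m" for N
      using assms(2) that by (rule keys_q_loop)
    have ku: "Poly_Mapping.keys ?u \<subseteq> cells (box d N) i"
      and kl: "Poly_Mapping.keys ?l \<subseteq> cells (box d N) i" if "N \<ge> 2 * m" for N
      using kg[OF that] keys_halves by blast+
    obtain U where U: "integral\<^sup>L \<mu> (wilson q ?u) = of_real U" "?P ?u \<longlonglongrightarrow> U"
      using wilson_limit[OF params assms(6) ku[OF order_refl]] .
    obtain L where L: "integral\<^sup>L \<mu> (wilson q ?l) = of_real L" "?P ?l \<longlonglongrightarrow> L"
      using wilson_limit[OF params assms(6) kl[OF order_refl]] .
    obtain G where G: "integral\<^sup>L \<mu> (wilson q ?g) = of_real G" "?P ?g \<longlonglongrightarrow> G"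
      using wilson_limit[OF params assms(6) kg[OF order_refl]] .
    have "i < d" using assms(2) by simp
    note reflect = box_prob_reflect[OF params this, where n = "2 * m"]
    have "U \<le> L"
      using ku reflect[OF _ lookup_halves_reflect(1)]
      by (intro LIMSEQ_le[OF U(2) LIMSEQ_ignore_initial_segment[OF L(2), of "2 * m"]]) blast
    moreover have "L \<le> U"
      using kl reflect[OF _ lookup_halves_reflect(2)]
      by (intro LIMSEQ_le[OF L(2) LIMSEQ_ignore_initial_segment[OF U(2), of "2 * m"]]) blast
    ultimately have UL: "U = L" by simp
    interpret first: higgs_box i d q "2 * m" \<beta>\<^sub>2 \<beta>\<^sub>1 using params by unfold_locales
    have "?P ?g (2 * m) \<le> G"
      using box_prob_mono[OF params _ kg[OF order_refl]]
      by (intro Lim_bounded2[OF G(2), of "2 * m"]) auto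
    then have G_pos: "G > 0" using first.box_prob_pos[of ?g] by simp
    have "real (2 * m) * (?P ?u N * ?P ?l N) \<le> M * ?P ?g N" if "N > 2 * m" for N
    proof -
      interpret higgs_box i d q N \<beta>\<^sub>2 \<beta>\<^sub>1 using params by unfold_locales
      show ?thesis
        using forcing_prob_halves[OF assms(1,2) that K] by (simp add: box_prob_def M_def)
    qed
    then have bound: "real (2 * m) * (U * L) \<le> M * G"
      by (intro LIMSEQ_le[OF tendsto_mult_left[OF tendsto_mult[OF U(2) L(2)]] tendsto_mult_left[OF G(2)]])
        (auto intro: exI[of _ "Suc (2 * m)"])
    have ratio: "mf_ratio \<mu> q i (2 * m) = of_real (U * U / G)"
      by (simp add: mf_ratio_def U L G UL)
    have "norm (mf_ratio \<mu> q i (2 * m)) = U * U / G"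
      using G_pos by (simp only: ratio norm_of_real) (simp add: abs_mult)
    then have "real (2 * m) * norm (mf_ratio \<mu> q i (2 * m)) = real (2 * m) * (U * L) / G"
      by (simp add: UL)
    also have "\<dots> \<le> M" using bound G_pos by (simp only: pos_divide_le_eq)
    finally have "real (2 * m) * norm (mf_ratio \<mu> q i (2 * m)) \<le> M" .
    then show ?thesis using U L G UL G_pos by simp
  qed
  have "(\<lambda>m. mf_ratio \<mu> q i (2 * m)) \<longlonglongrightarrow> 0"
  proof (rule Lim_null_comparison)
    have "norm (mf_ratio \<mu> q i (2 * m)) \<le> M * inverse (real m)" if "m \<ge> 1" for m
    proof -
      have "real m * norm (mf_ratio \<mu> q i (2 * m)) \<le> real (2 * m) * norm (mf_ratio \<mu> q i (2 * m))"
        by (intro mult_right_mono) auto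
      also have "\<dots> \<le> M" using main by blast
      finally show ?thesis using that by (simp add: field_simps)
    qed
    then show "\<forall>\<^sub>F m in sequentially. norm (mf_ratio \<mu> q i (2 * m)) \<le> M * inverse (real m)"
      by (rule eventually_sequentiallyI)
    show "(\<lambda>m. M * inverse (real m)) \<longlonglongrightarrow> 0"
      by (rule tendsto_mult_right_zero[OF lim_inverse_n])
  qed
  moreover have "integral\<^sup>L \<mu> (wilson q (q_loop i n)) \<noteq> 0 \<and> mf_ratio \<mu> q i n =
      (integral\<^sup>L \<mu> (wilson q (q_upper i n)))\<^sup>2 / integral\<^sup>L \<mu> (wilson q (q_loop i n))" if "even n" for n
  proof -
    from that obtain m where "n = 2 * m" by (rule evenE)
    then show ?thesis using main[of m] by (simp add: mf_ratio_def power2_eq_square)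
  qed
  ultimately show ?thesis by blast
qed

end
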